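(* Let $p\neq 2$ be a prime and let $$G=Z_{p^{\lambda_1}}\times Z_{p^{\lambda_2}}\times \cdots \times Z_{p^{\lambda_n}},\quad 0<\lambda_1<\lambda_2<\cdots<\lambda_n,$$ $$H=Z_{p^{\mu_1}}\times Z_{p^{\mu_2}}\times \cdots \times Z_{p^{\mu_m}},\quad 0<\mu_1<\mu_2<\cdots<\mu_m,\quad m\le n.$$ Then the lattices of characteristic subgroups of $G$ and $H$ are isomorphic if and only if one of the following holds: (i) $G=H$ (i.e. $m=n$ and $\lambda_i=\mu_i$ for all $i$); (ii) $G=Z_{p^k}\times Z_{p^{k+1}}$ and $H=Z_{p^{2k+1}}$ for some integer $k\ge 1$; (iii) $G=Z_p\times Z_{p^2}\times Z_{p^4}$ and $H=Z_{p^2}\times Z_{p^5}$.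
   Context: $Z_{p^a}$ denotes the cyclic group of order $p^a$. For a group $G$, the lattice of characteristic subgroups of $G$ (ordered by inclusion, with intersection as meet and the generated subgroup as join) is denoted $\mathrm{Char}(G)$. *)

theory Defs
  imports "HOL-Algebra.Algebra"
begin

definition cyc_prod :: "nat \<Rightarrow> nat list \<Rightarrow> nat list monoid" where
  "cyc_prod p ls =
     \<lparr> carrier = {xs. length xs = length ls \<and> (\<forall>i<length ls. xs ! i < p ^ (ls ! i))},
       monoid.mult = (\<lambda>xs ys. map (\<lambda>i. (xs ! i + ys ! i) mod p ^ (ls ! i)) [0..<length ls]),
       monoid.one = replicate (length ls) 0 \<rparr>"

definition characteristic :: "'a set \<Rightarrow> ('a, 'b) monoid_scheme \<Rightarrow> bool" where
  "characteristic H G \<longleftrightarrow> subgroup H G \<and> (\<forall>\<phi> \<in> iso G G. \<phi> ` H = H)"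

definition Char :: "('a, 'b) monoid_scheme \<Rightarrow> 'a set set" where
  "Char G = {H. characteristic H G}"

text \<open>Isomorphism of the lattices (Char G, \<subseteq>) and (Char H, \<subseteq>): an order isomorphism
  (equivalently, a bijection preserving intersection and generated-subgroup join).\<close>
definition char_lattice_iso :: "('a, 'b) monoid_scheme \<Rightarrow> ('c, 'd) monoid_scheme \<Rightarrow> bool" where
  "char_lattice_iso G H \<longleftrightarrow>
     (\<exists>f. bij_betw f (Char G) (Char H) \<and>
          (\<forall>A\<in>Char G. \<forall>B\<in>Char G. A \<subseteq> B \<longleftrightarrow> f A \<subseteq> f B))"

end

(* For odd p every characteristic subgroup of G is a product of subgroups of the cyclic factors:
   doubling one coordinate is an automorphism.  Writing p^(a l) for the order of the component in
   the factor of order p^l, the transvections between the factors force a to be monotone with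
   increments bounded by those of l; all such a do occur, since the corresponding subgroup is
   {x. \<forall>l. p^(a l) x \<in> p^l G}.  Hence Char G is a distributive lattice of integer tuples,
   determined by the poset of its join-primes.  These are the points (x, y) with x \<ge> 1, y \<ge> 0 and
   x + y among the exponents L, ordered by increasing x and decreasing y.

   To classify these posets let N be the largest exponent, and call "critical" the maximal points
   among those incomparable to something.  Unless the poset is a chain (one exponent, or two
   consecutive ones), there are two critical points: s = (N - 1, 1) and q, where q = (a, 0) for the
   second largest exponent a if a + 2 \<le> N, and q = (b, 0) for the third largest exponent b if
   a + 1 = N.  The points below s form the poset of the exponents lowered by one.  An isomorphism
   matching s with s' is therefore handled by induction; one that matches s with q' is pinned down by
   counting the points not below s and q and looking at the critical points below q, and this
   produces the exceptional pair {1, 2, 4}, {2, 5}. *)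
theory Submission
  imports Defs "HOL-Number_Theory.Cong"
begin

section \<open>Posets of points\<close>

text \<open>The point (x, y) encodes the least tuple whose entry at the exponent x + y is at least
  x, see \<open>jtuple\<close>. Recording y, the distance of that entry from its exponent, turns the
  order of these tuples into a product order with the second factor reversed.\<close>

definition point_le :: "nat \<times> nat \<Rightarrow> nat \<times> nat \<Rightarrow> bool" where
  "point_le z w \<longleftrightarrow> fst z \<le> fst w \<and> snd w \<le> snd z"

definition points :: "nat set \<Rightarrow> (nat \<times> nat) set" where
  "points L = {(x, y). 1 \<le> x \<and> x + y \<in> L}"

lemma point_le_pair [simp]: "point_le (x, y) (x', y') \<longleftrightarrow> x \<le> x' \<and> y' \<le> y"
  by (simp add: point_le_def)

lemma mem_points [simp]: "(x, y) \<in> points L \<longleftrightarrow> 1 \<le> x \<and> x + y \<in> L"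
  by (simp add: points_def)

lemma point_le_refl [simp]: "point_le z z"
  by (simp add: point_le_def)

lemma point_le_trans: "point_le u v \<Longrightarrow> point_le v w \<Longrightarrow> point_le u w"
  by (auto simp: point_le_def)

lemma point_le_antisym: "point_le u v \<Longrightarrow> point_le v u \<Longrightarrow> u = v"
  by (auto simp: point_le_def prod_eq_iff)

lemma bij_betw_points: "bij_betw (\<lambda>(l, x). (x, l - x)) (SIGMA l:L. {1..l}) (points L)"
  by (rule bij_betw_byWitness[where f' = "\<lambda>(x, y). (x + y, x)"]) (auto simp: points_def)

text \<open>Each exponent l contributes the l points with x + y = l. So the sum of the exponents is
  an isomorphism invariant; it settles every case in which only one parameter is left.\<close>

lemma card_points:
  assumes "finite L"
  shows "card (points L) = \<Sum>L"
proof -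
  have "card (points L) = card (SIGMA l:L. {1..l})"
    by (metis bij_betw_same_card[OF bij_betw_points])
  then show ?thesis using assms by simp
qed

lemma finite_points: "finite L \<Longrightarrow> finite (points L)"
  using bij_betw_finite[OF bij_betw_points] by blast

section \<open>Order isomorphisms and their restrictions\<close>

definition order_iso ::
    "('a \<Rightarrow> 'a \<Rightarrow> bool) \<Rightarrow> ('b \<Rightarrow> 'b \<Rightarrow> bool) \<Rightarrow> ('a \<Rightarrow> 'b) \<Rightarrow> 'a set \<Rightarrow> 'b set \<Rightarrow> bool" where
  "order_iso r r' f A B \<longleftrightarrow> bij_betw f A B \<and> (\<forall>x\<in>A. \<forall>y\<in>A. r x y \<longleftrightarrow> r' (f x) (f y))"

lemma order_iso_iff:
  "order_iso r r' f A B \<Longrightarrow> x \<in> A \<Longrightarrow> y \<in> A \<Longrightarrow> r' (f x) (f y) \<longleftrightarrow> r x y"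
  unfolding order_iso_def by blast

lemma order_iso_inv:
  assumes "order_iso r r' f A B"
  shows "order_iso r' r (inv_into A f) B A"
  using assms unfolding order_iso_def
  by (auto simp: bij_betw_inv_into bij_betw_inv_into_right bij_betw_imp_surj_on inv_into_into)

lemma order_iso_comp:
  assumes "order_iso r r' f A B" "order_iso r' r'' g B C"
  shows "order_iso r r'' (g \<circ> f) A C"
  using assms unfolding order_iso_def by (auto intro: bij_betw_trans simp: bij_betw_apply)

lemma order_iso_restrict:
  assumes "order_iso r r' f A B" "\<And>x. x \<in> A \<Longrightarrow> P x \<longleftrightarrow> Q (f x)"
  shows "order_iso r r' f {x \<in> A. P x} {y \<in> B. Q y}"
proof -
  have "f ` {x \<in> A. P x} = {y \<in> B. Q y}"
    using assms unfolding order_iso_def bij_betw_def by auto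
  then show ?thesis
    using assms unfolding order_iso_def bij_betw_def by (auto intro: inj_on_subset)
qed

lemma order_iso_card:
  assumes "order_iso r r' f A B"
  shows "card A = card B"
  using assms bij_betw_same_card unfolding order_iso_def by blast

abbreviation "point_iso \<equiv> order_iso point_le point_le"

section \<open>Isomorphism invariants: down-sets, their complements, the critical pair\<close>

definition below :: "(nat \<times> nat) set \<Rightarrow> nat \<times> nat \<Rightarrow> (nat \<times> nat) set" where
  "below A z = {w \<in> A. point_le w z}"

definition not_below :: "(nat \<times> nat) set \<Rightarrow> nat \<times> nat \<Rightarrow> (nat \<times> nat) set" where
  "not_below A z = {w \<in> A. \<not> point_le w z}"

lemma point_iso_below:
  assumes "point_iso f A B" "z \<in> A"
  shows "point_iso f (below A z) (below B (f z))"
  unfolding below_def using assms(1)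
  by (rule order_iso_restrict) (use assms in \<open>blast dest: order_iso_iff\<close>)

lemma point_iso_not_below:
  assumes "point_iso f A B" "z \<in> A"
  shows "point_iso f (not_below A z) (not_below B (f z))"
  unfolding not_below_def using assms(1)
  by (rule order_iso_restrict) (use assms in \<open>blast dest: order_iso_iff\<close>)

text \<open>For the critical pair this number is 1 if the two largest exponents differ by at least
  2, and 2 if they are consecutive. It keeps the two cases from being isomorphic to each
  other.\<close>

lemma card_not_below_both:
  assumes "point_iso f A B" "z \<in> A" "w \<in> A"
  shows "card (not_below A z \<inter> not_below A w) = card (not_below B (f z) \<inter> not_below B (f w))"
proof -
  have "point_iso f {u \<in> A. \<not> point_le u z \<and> \<not> point_le u w} {u \<in> B. \<not> point_le u (f z) \<and> \<not> point_le u (f w)}"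
    using assms(1) by (rule order_iso_restrict) (use assms in \<open>blast dest: order_iso_iff\<close>)
  moreover have "not_below A z \<inter> not_below A w = {u \<in> A. \<not> point_le u z \<and> \<not> point_le u w}" for A z w
    by (auto simp: not_below_def)
  ultimately show ?thesis by (metis order_iso_card)
qed

text \<open>Such a pair, if it exists, consists of the maximal elements among those which are
  incomparable to something; hence it is preserved by isomorphisms up to order.\<close>
definition critical :: "(nat \<times> nat) set \<Rightarrow> nat \<times> nat \<Rightarrow> nat \<times> nat \<Rightarrow> bool" where
  "critical A s q \<longleftrightarrow> s \<in> A \<and> q \<in> A \<and> \<not> point_le s q \<and> \<not> point_le q s \<and>
     (\<forall>z\<in>A. point_le z s \<or> point_le z q \<or> (\<forall>w\<in>A. point_le z w \<or> point_le w z))"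

lemma critical_point_iso:
  assumes f: "point_iso f A B" and c: "critical A s q"
  shows "critical B (f s) (f q)"
proof -
  have B: "B = f ` A" and i: "\<And>x y. x \<in> A \<Longrightarrow> y \<in> A \<Longrightarrow> point_le (f x) (f y) \<longleftrightarrow> point_le x y"
    using f by (auto simp: order_iso_def bij_betw_def)
  show ?thesis using c unfolding critical_def B by (simp add: i)
qed

lemma critical_sym: "critical A s q \<Longrightarrow> critical A q s"
  unfolding critical_def by blast

text \<open>Each member of a critical pair is incomparable to something, hence lies below a member
  of any other such pair. Going from \<open>s'\<close> up to the first pair and back up ends at
  \<open>s'\<close> or \<open>q'\<close>; the latter is incomparable to \<open>s'\<close>, so
  antisymmetry applies.\<close>

lemma critical_unique:
  assumes "critical A s q" "critical A s' q'"
  shows "s = s' \<and> q = q' \<or> s = q' \<and> q = s'"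
proof -
  have "s' = s \<or> s' = q" if "critical A s q" "critical A s' q'" for s q s' q'
  proof -
    have "point_le s' s \<or> point_le s' q" "point_le s s' \<or> point_le s q'" "point_le q s' \<or> point_le q q'"
      using that unfolding critical_def by blast+
    moreover have "\<not> point_le s' q'" using that by (simp add: critical_def)
    ultimately show ?thesis by (meson point_le_trans point_le_antisym)
  qed
  then have "s' = s \<or> s' = q" "q' = s \<or> q' = q"
    using assms critical_sym by blast+
  moreover have "s' \<noteq> q'" using assms(2) by (auto simp: critical_def)
  ultimately show ?thesis by blast
qed

lemma critical_point_iso_cases:
  assumes "point_iso f A B" "critical A s q" "critical B s' q'"
  shows "f s = s' \<and> f q = q' \<or> f s = q' \<and> f q = s'"
  using critical_unique[OF critical_point_iso] assms by blast

section \<open>The largest exponents and the critical pair they produce\<close>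

definition lowered :: "nat set \<Rightarrow> nat set" where
  "lowered L = {l. 1 \<le> l \<and> Suc l \<in> L}"

definition wide_top :: "nat set \<Rightarrow> nat \<Rightarrow> nat \<Rightarrow> bool" where
  "wide_top L N a \<longleftrightarrow> finite L \<and> 0 \<notin> L \<and> N \<in> L \<and> a \<in> L \<and> a + 2 \<le> N \<and> (\<forall>l\<in>L. l = N \<or> l \<le> a)"

text \<open>A third exponent \<open>b\<close> is demanded because two consecutive exponents alone
  give a chain, which has no critical pair.\<close>

definition narrow_top :: "nat set \<Rightarrow> nat \<Rightarrow> nat \<Rightarrow> bool" where
  "narrow_top L a b \<longleftrightarrow> finite L \<and> 0 \<notin> L \<and> Suc a \<in> L \<and> a \<in> L \<and> b \<in> L \<and> b < a \<and>
     (\<forall>l\<in>L. l = Suc a \<or> l = a \<or> l \<le> b)"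

lemma greatest_below_top:
  fixes L :: "nat set"
  assumes "finite L" "L \<noteq> {}"
  obtains N where "N \<in> L" "\<And>l. l \<in> L \<Longrightarrow> l \<le> N"
  using assms Max_in Max_ge by blast

lemma top_cases:
  assumes "finite L" "L \<noteq> {}" "0 \<notin> L"
  obtains (single) N where "L = {N}"
    | (pair) a where "L = {a, Suc a}"
    | (A) N a where "wide_top L N a"
    | (B) a b where "narrow_top L a b"
proof -
  obtain N where N: "N \<in> L" "\<And>l. l \<in> L \<Longrightarrow> l \<le> N"
    using greatest_below_top assms by blast
  show ?thesis
  proof (cases "L - {N} = {}")
    case True
    then show ?thesis using single N by blast
  next
    case False
    then obtain a where a: "a \<in> L - {N}" "\<And>l. l \<in> L - {N} \<Longrightarrow> l \<le> a"
      using greatest_below_top[of "L - {N}"] assms(1) by blast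
    have aN: "a < N" using a(1) N(2)[of a] by auto
    show ?thesis
    proof (cases "N = Suc a")
      case N': True
      show ?thesis
      proof (cases "L - {N, a} = {}")
        case True
        then have "L = {a, Suc a}" using N a N' by auto
        then show ?thesis by (rule pair)
      next
        case False
        then obtain b where b: "b \<in> L - {N, a}" "\<And>l. l \<in> L - {N, a} \<Longrightarrow> l \<le> b"
          using greatest_below_top[of "L - {N, a}"] assms(1) by blast
        have "b < a" using b(1) a(2)[of b] by auto
        then have "narrow_top L a b" using N' N a b assms unfolding narrow_top_def by auto
        then show ?thesis by (rule B)
      qed
    next
      case False
      then have "wide_top L N a" using N a aN assms unfolding wide_top_def by auto
      then show ?thesis by (rule A)
    qed
  qed
qed

text \<open>A point fails to be below \<open>(N - 1, 1)\<close> if y = 0 or x = N, and the latter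
  forces y = 0 because x + y is at most N. This leaves one point per exponent.\<close>

lemma not_below_second:
  assumes "N \<in> L" "0 \<notin> L" "\<forall>l\<in>L. l \<le> N"
  shows "not_below (points L) (N - 1, 1) = (\<lambda>l. (l, 0)) ` L"
proof (intro Set.set_eqI iffI)
  fix z :: "nat \<times> nat" assume "z \<in> not_below (points L) (N - 1, 1)"
  then obtain x y where z: "z = (x, y)" "1 \<le> x" "x + y \<in> L" "\<not> (x \<le> N - 1 \<and> 1 \<le> y)"
    by (cases z) (auto simp: not_below_def)
  have "x + y \<le> N" using z assms by blast
  then have "y = 0" using z by auto
  then show "z \<in> (\<lambda>l. (l, 0)) ` L" using z by auto
next
  fix z :: "nat \<times> nat" assume "z \<in> (\<lambda>l. (l, 0)) ` L"
  then show "z \<in> not_below (points L) (N - 1, 1)" using assms(2)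
    by (auto simp: not_below_def Suc_le_eq intro!: gr0I)
qed

lemma card_not_below_second:
  assumes "N \<in> L" "0 \<notin> L" "\<forall>l\<in>L. l \<le> N"
  shows "card (not_below (points L) (N - 1, 1)) = card L"
  unfolding not_below_second[OF assms] by (rule card_image) (simp add: inj_on_def)

text \<open>The down-set consists of all points with y at least 1, the bound on x being automatic
  from x + y \<le> N. Subtracting 1 from y lowers the exponent x + y by one.\<close>

lemma point_iso_lowered:
  assumes "\<forall>l\<in>L. l \<le> N"
  shows "point_iso (\<lambda>(x, y). (x, y - 1)) (below (points L) (N - 1, 1)) (points (lowered L))"
proof -
  have 1: "y \<ge> 1" if "(x, y) \<in> below (points L) (N - 1, 1)" for x y using that by (auto simp: below_def)
  have 2: "x \<le> N - Suc 0" if "Suc (x + y) \<in> L" for x y using assms that by fastforce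
  have "bij_betw (\<lambda>(x, y). (x, y - 1)) (below (points L) (N - 1, 1)) (points (lowered L))"
    by (rule bij_betw_byWitness[where f' = "\<lambda>(x, y). (x, Suc y)"])
      (auto simp: lowered_def below_def dest: 2)
  moreover have "point_le z w \<longleftrightarrow> point_le ((\<lambda>(x, y). (x, y - 1)) z) ((\<lambda>(x, y). (x, y - 1)) w)"
    if "z \<in> below (points L) (N - 1, 1)" "w \<in> below (points L) (N - 1, 1)" for z w
    using that 1 by (cases z; cases w) fastforce
  ultimately show ?thesis unfolding order_iso_def by blast
qed

lemma wide_top_facts:
  assumes "wide_top L N a"
  shows "critical (points L) (N - 1, 1) (a, 0)"
    and "card (not_below (points L) (N - 1, 1)) = card L"
    and "card (not_below (points L) (a, 0)) = N - a"
    and "card (not_below (points L) (N - 1, 1) \<inter> not_below (points L) (a, 0)) = 1"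
    and "\<forall>l\<in>L. l \<le> N"
proof -
  have L: "finite L" "0 \<notin> L" "N \<in> L" "a \<in> L" "a + 2 \<le> N" "\<And>l. l \<in> L \<Longrightarrow> l = N \<or> l \<le> a"
    using assms by (auto simp: wide_top_def)
  have a: "a \<ge> 1" using L by (cases a) auto
  show m: "\<forall>l\<in>L. l \<le> N"
  proof
    fix l assume "l \<in> L"
    from L(6)[OF this] L(5) show "l \<le> N" by auto
  qed
  have top: "point_le w (N, 0)" if "w \<in> points L" for w using that m by (cases w) auto
  \<comment> \<open>Points with y \<ge> 1 have x \<le> N - 1. Points with y = 0 have x in
    \<open>L\<close>, so x \<le> a or x = N. Only the greatest point escapes, and it is comparable
    to everything.\<close>
  have "point_le z (N - 1, 1) \<or> point_le z (a, 0) \<or> z = (N, 0)" if "z \<in> points L" for z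
  proof (cases z)
    case (Pair x y)
    then have "x + y \<in> L" "x + y \<le> N" using that m by auto
    then show ?thesis using L(6)[of "x + y"] Pair by (cases y) auto
  qed
  then show "critical (points L) (N - 1, 1) (a, 0)"
    unfolding critical_def using L(2-5) a top by auto
  show "card (not_below (points L) (N - 1, 1)) = card L"
    using card_not_below_second L m by blast
  \<comment> \<open>A point with x > a has an exponent larger than a, which must be N; there is one
    such point for each x.\<close>
  have "not_below (points L) (a, 0) = (\<lambda>x. (x, N - x)) ` {a<..N}"
  proof (intro Set.set_eqI iffI)
    fix z :: "nat \<times> nat" assume "z \<in> not_below (points L) (a, 0)"
    then show "z \<in> (\<lambda>x. (x, N - x)) ` {a<..N}"
      using L(6) by (cases z) (force simp: not_below_def)
  qed (use L in \<open>auto simp: not_below_def\<close>)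
  then show "card (not_below (points L) (a, 0)) = N - a"
    by (simp add: card_image inj_on_def)
  have "not_below (points L) (N - 1, 1) \<inter> not_below (points L) (a, 0) = {(N, 0)}"
    unfolding not_below_second[OF L(3,2) m] using L by (force simp: not_below_def)
  then show "card (not_below (points L) (N - 1, 1) \<inter> not_below (points L) (a, 0)) = 1" by simp
qed

lemma narrow_top_facts:
  assumes "narrow_top L a b"
  shows "critical (points L) (a, 1) (b, 0)"
    and "card (not_below (points L) (a, 1)) = card L"
    and "card (not_below (points L) (b, 0)) = 2 * (a - b) + 1"
    and "card (not_below (points L) (a, 1) \<inter> not_below (points L) (b, 0)) = 2"
    and "\<forall>l\<in>L. l \<le> Suc a"
proof -
  have L: "finite L" "0 \<notin> L" "Suc a \<in> L" "a \<in> L" "b \<in> L" "b < a"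
    "\<And>l. l \<in> L \<Longrightarrow> l = Suc a \<or> l = a \<or> l \<le> b"
    using assms by (auto simp: narrow_top_def)
  have b: "b \<ge> 1" using L by (cases b) auto
  show m: "\<forall>l\<in>L. l \<le> Suc a"
  proof
    fix l assume "l \<in> L"
    from L(7)[OF this] L(6) show "l \<le> Suc a" by auto
  qed
  have top: "point_le w (Suc a, 0)" if "w \<in> points L" for w using that m by (cases w) auto
  \<comment> \<open>x = Suc a would force y = 0. Hence \<open>(a, 0)\<close> is above everything
    except the greatest point, and both are comparable to all points.\<close>
  have second: "point_le w (a, 0) \<or> w = (Suc a, 0)" if "w \<in> points L" for w
  proof (cases w)
    case (Pair x y)
    then have "x + y \<le> Suc a" using that m by auto
    then show ?thesis using Pair by auto
  qed
  have "point_le z (a, 1) \<or> point_le z (b, 0) \<or> z = (Suc a, 0) \<or> z = (a, 0)" if "z \<in> points L" for z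
  proof (cases z)
    case (Pair x y)
    then have "x + y \<in> L" "x + y \<le> Suc a" using that m by auto
    then show ?thesis using L(7)[of "x + y"] Pair by (cases y) auto
  qed
  moreover have "point_le z w \<or> point_le w z" if "z = (Suc a, 0) \<or> z = (a, 0)" "w \<in> points L" for z w
    using that top[of w] second[of w] by auto
  moreover have "(a, 1) \<in> points L" "(b, 0) \<in> points L" "\<not> point_le (a, 1) (b, 0)" "\<not> point_le (b, 0) (a, 1)"
    using L(3-6) b by auto
  ultimately show "critical (points L) (a, 1) (b, 0)"
    unfolding critical_def by blast
  show "card (not_below (points L) (a, 1)) = card L"
    using card_not_below_second[OF L(3,2) m] by simp
  \<comment> \<open>Points with x > b lie on one of the exponents a and Suc a, which contribute a -
    b and a - b + 1 of them.\<close>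
  have "not_below (points L) (b, 0) = (\<lambda>x. (x, a - x)) ` {b<..a} \<union> (\<lambda>x. (x, Suc a - x)) ` {b<..Suc a}"
    (is "?l = ?r")
  proof (intro Set.set_eqI iffI)
    fix z :: "nat \<times> nat" assume "z \<in> ?l"
    then obtain x y where z: "z = (x, y)" "x + y \<in> L" "b < x" by (cases z) (auto simp: not_below_def)
    then have "x + y = a \<or> x + y = Suc a" using L(7)[of "x + y"] by auto
    then show "z \<in> ?r" using z by (auto simp: image_iff)
  qed (use L in \<open>auto simp: not_below_def\<close>)
  moreover have "(\<lambda>x. (x, a - x)) ` {b<..a} \<inter> (\<lambda>x. (x, Suc a - x)) ` {b<..Suc a} = {}"
    by auto
  ultimately show "card (not_below (points L) (b, 0)) = 2 * (a - b) + 1"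
    using L by (simp add: card_Un_disjoint card_image inj_on_def)
  have "not_below (points L) (a, 1) = (\<lambda>l. (l, 0)) ` L"
    using not_below_second[OF L(3,2) m] by simp
  then have "not_below (points L) (a, 1) \<inter> not_below (points L) (b, 0) = {(a, 0), (Suc a, 0)}"
    using L by (force simp: not_below_def)
  then show "card (not_below (points L) (a, 1) \<inter> not_below (points L) (b, 0)) = 2" by simp
qed

section \<open>Lowering all exponents by one, where only the exponent 1 is lost\<close>

lemma card_lowered:
  assumes "finite L" "0 \<notin> L"
  shows "card L = card (lowered L) + (if 1 \<in> L then 1 else 0)"
    and "L = Suc ` lowered L \<union> (if 1 \<in> L then {1} else {})"
    and "finite (lowered L)"
proof -
  have "l \<in> Suc ` lowered L" if "l \<in> L" "l \<noteq> 1" for l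
    using that assms by (cases l) (auto simp: lowered_def Suc_le_eq image_iff intro!: gr0I)
  moreover have s: "Suc ` lowered L \<subseteq> L" by (auto simp: lowered_def)
  ultimately show *: "L = Suc ` lowered L \<union> (if 1 \<in> L then {1} else {})" by auto
  have f: "finite (Suc ` lowered L)" using s assms finite_subset by blast
  then show "finite (lowered L)" by (rule finite_imageD) simp
  have "1 \<notin> Suc ` lowered L" by (auto simp: lowered_def)
  then have "card (Suc ` lowered L \<union> (if 1 \<in> L then {1} else {})) =
      card (Suc ` lowered L) + (if 1 \<in> L then 1 else 0)" using f by simp
  then show "card L = card (lowered L) + (if 1 \<in> L then 1 else 0)"
    using * by (simp add: card_image)
qed

text \<open>The relation is directed: \<open>L\<close> has one exponent more than
  \<open>M\<close>.\<close>

definition exceptional :: "nat set \<Rightarrow> nat set \<Rightarrow> bool" where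
  "exceptional L M \<longleftrightarrow> (\<exists>k\<ge>1. L = {k, Suc k} \<and> M = {2 * k + 1}) \<or> L = {1, 2, 4} \<and> M = {2, 5}"

text \<open>This records what is known, besides equal cardinality, when an isomorphism matches the
  two critical pairs in order. The gap between the two largest exponents is visible as the number of
  points not below the second critical point.\<close>

definition same_type :: "nat set \<Rightarrow> nat set \<Rightarrow> bool" where
  "same_type L M \<longleftrightarrow> (\<exists>N a N' a'. wide_top L N a \<and> wide_top M N' a' \<and> N - a = N' - a') \<or>
     (\<exists>a b a' b'. narrow_top L a b \<and> narrow_top M a' b')"

text \<open>The lowered sets would differ in size by one, so only \<open>M\<close> loses the
  exponent 1. Then \<open>L\<close> is a pair of consecutive exponents and is of neither type, or
  \<open>L = {2, 3, 5}\<close> and \<open>M = {1, 3, 6}\<close>, whose top gaps are 2 and 3.\<close>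

lemma not_exceptional_lowered:
  assumes "same_type L M" "card L = card M"
  shows "\<not> exceptional (lowered L) (lowered M)"
proof
  assume e: "exceptional (lowered L) (lowered M)"
  have f: "finite L" "0 \<notin> L" "finite M" "0 \<notin> M"
    using assms by (auto simp: same_type_def wide_top_def narrow_top_def)
  have cL: "card (lowered L) = card (lowered M) + 1"
    using e by (auto simp: exceptional_def)
  then have "(if 1 \<in> L then 1 else 0) + 1 = (if 1 \<in> M then 1 else 0 :: nat)"
    using card_lowered(1)[OF f(1,2)] card_lowered(1)[OF f(3,4)] assms(2) by linarith
  then have 1: "1 \<notin> L" "1 \<in> M" by (auto split: if_splits)
  have L: "L = Suc ` lowered L" and M: "M = insert 1 (Suc ` lowered M)"
    using card_lowered(2)[OF f(1,2)] card_lowered(2)[OF f(3,4)] 1 by simp_all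
  consider k where "L = {k, Suc k}" | "L = {2, 3, 5}" "M = {1, 3, 6}"
    using e unfolding exceptional_def
  proof (elim disjE exE conjE)
    fix k assume "lowered L = {k, Suc k}"
    then have "L = {Suc k, Suc (Suc k)}" by (subst L) simp
    then show ?thesis by (rule that(1))
  next
    assume "lowered L = {1, 2, 4}" "lowered M = {2, 5}"
    have "L = {2, 3, 5}" by (subst L, subst \<open>lowered L = _\<close>) (simp add: eval_nat_numeral)
    moreover have "M = {1, 3, 6}" by (subst M, subst \<open>lowered M = _\<close>) simp
    ultimately show ?thesis by (rule that(2))
  qed
  then show False
  proof cases
    case (1 k)
    have "\<not> wide_top {k, Suc k} N a" for N a by (auto simp: wide_top_def)
    moreover have "\<not> narrow_top {k, Suc k} a b" for a b by (auto simp: narrow_top_def)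
    ultimately show False using assms(1) 1 by (auto simp: same_type_def)
  next
    case 2
    have "N - a = 2" if "wide_top {2, 3, 5} N a" for N a using that by (auto simp: wide_top_def)
    moreover have "N - a = 3" if "wide_top {1, 3, 6} N a" for N a using that by (auto simp: wide_top_def)
    moreover have "\<not> narrow_top {2, 3, 5} a b" for a b
    proof
      assume "narrow_top {2, 3, 5} a b"
      then have "Suc a \<in> {2, 3, 5}" "5 = Suc a \<or> 5 = a \<or> 5 \<le> b" "b < a" "a \<in> {2, 3, 5}"
        unfolding narrow_top_def by blast+
      then show False by auto
    qed
    ultimately show False using assms(1) 2 by (fastforce simp: same_type_def)
  qed
qed

text \<open>Equal cardinalities make both sets agree on whether the exponent 1 was lost.\<close>

lemma lowered_inject:
  assumes "lowered L = lowered M" "card L = card M" "finite L" "0 \<notin> L" "finite M" "0 \<notin> M"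
  shows "L = M"
proof -
  have *: "P \<longleftrightarrow> Q" if "c = d + (if P then 1 else 0)" "c = d + (if Q then 1 else 0)"
    for c d :: nat and P Q using that by (auto split: if_splits)
  have "1 \<in> L \<longleftrightarrow> 1 \<in> M"
    by (rule *[of "card L" "card (lowered L)"], rule card_lowered(1)[OF assms(3,4)], subst assms(2),
        subst assms(1), rule card_lowered(1)[OF assms(5,6)])
  then have "Suc ` lowered L \<union> (if 1 \<in> L then {1} else {}) = Suc ` lowered M \<union> (if 1 \<in> M then {1} else {})"
    by (simp only: assms(1))
  then show ?thesis
    by (simp only: card_lowered(2)[OF assms(3,4), symmetric] card_lowered(2)[OF assms(5,6), symmetric])
qed

lemma wide_top_lowered:
  assumes "wide_top L N a" "a \<noteq> 1"
  shows "wide_top (lowered L) (N - 1) (a - 1)"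
proof -
  have L: "finite L" "0 \<notin> L" "N \<in> L" "a \<in> L" "a + 2 \<le> N" "\<And>l. l \<in> L \<Longrightarrow> l = N \<or> l \<le> a"
    using assms by (auto simp: wide_top_def)
  have "a > 1" using L assms(2) by (cases a) auto
  moreover have "l = N - 1 \<or> l \<le> a - 1" if "Suc l \<in> L" for l using L(6)[OF that] by auto
  ultimately show ?thesis unfolding wide_top_def using L card_lowered(3)[OF L(1,2)] by (auto simp: lowered_def)
qed

lemma lowered_wide_top_one:
  assumes "wide_top L N 1"
  shows "lowered L = {N - 1}"
proof -
  have "0 \<notin> L" "N \<in> L" "3 \<le> N" "\<And>l. l \<in> L \<Longrightarrow> l = N \<or> l \<le> 1"
    using assms by (auto simp: wide_top_def)
  then show ?thesis by (force simp: lowered_def)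
qed

lemma chain_single: "u \<in> points {N} \<Longrightarrow> v \<in> points {N} \<Longrightarrow> point_le u v \<or> point_le v u"
  by (auto simp: points_def)

lemma chain_pair: "u \<in> points {a, Suc a} \<Longrightarrow> v \<in> points {a, Suc a} \<Longrightarrow> point_le u v \<or> point_le v u"
  by (auto simp: points_def)

lemma critical_not_chain: "critical A s q \<Longrightarrow> \<not> (\<forall>u\<in>A. \<forall>v\<in>A. point_le u v \<or> point_le v u)"
  unfolding critical_def by blast

text \<open>Pigeonhole: pulled back to \<open>A\<close>, each member of the critical pair lies below
  some \<open>c\<close>, while each of the three \<open>c\<close> lies below a member of the pair.
  Two of them share such a member, so both lie below one and the same \<open>c\<close>, against
  incomparability.\<close>

lemma critical_no_triple:
  assumes "critical B s q" "point_iso f A B" "{c1, c2, c3} \<subseteq> A"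
    and "\<not> point_le c1 c2" "\<not> point_le c1 c3" "\<not> point_le c2 c1" "\<not> point_le c2 c3" "\<not> point_le c3 c1" "\<not> point_le c3 c2"
    and cov: "\<And>z. z \<in> A \<Longrightarrow> point_le z c1 \<or> point_le z c2 \<or> point_le z c3 \<or> (\<forall>w\<in>A. point_le w z)"
  shows False
proof -
  define g where "g = inv_into A f"
  have "point_iso g B A" unfolding g_def using assms(2) by (rule order_iso_inv)
  from critical_point_iso[OF this assms(1)] have c: "critical A (g s) (g q)" .
  define s' q' where sq: "s' = g s" "q' = g q"
  have "s' \<in> A" "q' \<in> A" "\<not> point_le s' q'" "\<not> point_le q' s'"
    using c sq by (auto simp: critical_def)
  then have s: "point_le s' c1 \<or> point_le s' c2 \<or> point_le s' c3" "point_le q' c1 \<or> point_le q' c2 \<or> point_le q' c3"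
    using cov by blast+
  have "c \<in> A \<Longrightarrow> \<not> point_le c d \<Longrightarrow> d \<in> A \<Longrightarrow> \<not> point_le d c \<Longrightarrow> point_le c s' \<or> point_le c q'" for c d
    using c unfolding critical_def sq by blast
  then have "point_le c1 s' \<or> point_le c1 q'" "point_le c2 s' \<or> point_le c2 q'" "point_le c3 s' \<or> point_le c3 q'"
    using assms by blast+
  moreover have "\<not> (point_le c1 t \<and> point_le c2 t)" "\<not> (point_le c1 t \<and> point_le c3 t)" "\<not> (point_le c2 t \<and> point_le c3 t)"
    if "point_le t c1 \<or> point_le t c2 \<or> point_le t c3" for t
    using that assms(4-9) point_le_trans[of _ t] by blast+
  ultimately show False using s by blast
qed

section \<open>Classification of the posets\<close>

text \<open>An isomorphism matching \<open>q\<close> with \<open>s'\<close> identifies the points below \<open>q\<close> with the poset of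
  \<open>lowered M\<close>.  With \<open>b\<close> the third largest exponent, below \<open>q\<close> there are three incomparable
  maximal points if \<open>b + 2 \<le> a\<close>, and the critical pair \<open>(b, 0)\<close>, \<open>(a, N - a)\<close> if \<open>b + 1 = a\<close>.\<close>
lemma wide_top_swapped:
  assumes A: "wide_top L N a" and M: "wide_top M N' a'" and c3: "card L \<ge> 3"
    and cL: "card L = N' - a'" and cM: "N - a = card M"
    and g: "point_iso g (below (points L) (a, 0)) (points (lowered M))" and sums: "\<Sum>L = \<Sum>M"
  shows "L = M \<or> exceptional L M"
proof -
  define D where "D = below (points L) (a, 0)"
  have L: "finite L" "0 \<notin> L" "N \<in> L" "a \<in> L" "a + 2 \<le> N" "\<And>l. l \<in> L \<Longrightarrow> l = N \<or> l \<le> a"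
    using A by (auto simp: wide_top_def)
  have M': "finite M" "0 \<notin> M" "N' \<in> M" "a' \<in> M" "a' + 2 \<le> N'" "\<And>l. l \<in> M \<Longrightarrow> l = N' \<or> l \<le> a'"
    using M by (auto simp: wide_top_def)
  have "L - {N, a} \<noteq> {}"
  proof
    assume "L - {N, a} = {}"
    then have "card L \<le> card {N, a}" by (intro card_mono) auto
    also have "\<dots> \<le> 2" by (simp add: card_insert_if)
    finally show False using c3 by simp
  qed
  then obtain b where b: "b \<in> L - {N, a}" "\<And>l. l \<in> L - {N, a} \<Longrightarrow> l \<le> b"
    using greatest_below_top[of "L - {N, a}"] L(1) by blast
  have ba: "b < a" using b(1) L(6)[of b] by auto
  have b1: "b \<ge> 1" using b(1) L(2) by (cases b) auto
  have top3: "l = N \<or> l = a \<or> l \<le> b" if "l \<in> L" for l using b(2)[of l] that by auto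
  have D: "(x, y) \<in> D \<longleftrightarrow> 1 \<le> x \<and> x \<le> a \<and> x + y \<in> L" for x y by (auto simp: D_def below_def)
  \<comment> \<open>Points with x = a have exponent a or N. The others satisfy x \<le> a - 1 if y
    \<ge> 1, and x \<le> b if y = 0, since then x itself is an exponent.\<close>
  have cov: "z = (a, 0) \<or> z = (a, N - a) \<or> point_le z (b, 0) \<or> point_le z (a - 1, 1)" if "z \<in> D" for z
  proof (cases z)
    case (Pair x y)
    then have *: "1 \<le> x" "x \<le> a" "x + y \<in> L" using that D by auto
    show ?thesis
    proof (cases "x = a")
      case True
      then show ?thesis using L(6)[OF *(3)] Pair by auto
    next
      case False
      then show ?thesis using top3[OF *(3)] * L(5) Pair by (cases y) auto
    qed
  qed
  have top: "point_le w (a, 0)" if "w \<in> D" for w using that D by (cases w) auto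
  \<comment> \<open>Otherwise \<open>lowered M\<close> is a single exponent, giving a chain, whereas
    \<open>D\<close> contains two incomparable points.\<close>
  have "a' \<noteq> 1"
  proof
    assume "a' = 1"
    then have "lowered M = {N' - 1}" using lowered_wide_top_one M by simp
    moreover have "(a, N - a) \<in> D" "(b, 0) \<in> D" using D L b ba b1 by auto
    then have "g (a, N - a) \<in> points (lowered M)" "g (b, 0) \<in> points (lowered M)"
      using g unfolding D_def order_iso_def by (auto dest: bij_betw_apply)
    ultimately have "point_le (g (a, N - a)) (g (b, 0)) \<or> point_le (g (b, 0)) (g (a, N - a))"
      using chain_single by simp
    then have "point_le (a, N - a) (b, 0) \<or> point_le (b, 0) (a, N - a)"
      using order_iso_iff[OF g[folded D_def]] \<open>(a, N - a) \<in> D\<close> \<open>(b, 0) \<in> D\<close> by blast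
    then show False using ba L(5) by auto
  qed
  note P = wide_top_facts[OF wide_top_lowered[OF M this]]
  have "b + 1 = a"
  proof (rule ccontr)
    assume "b + 1 \<noteq> a"
    then have b2: "b + 2 \<le> a" using ba by simp
    show False
    proof (rule critical_no_triple[OF P(1) g[folded D_def],
          where ?c1.0 = "(a - 1, 1)" and ?c2.0 = "(b, 0)" and ?c3.0 = "(a, N - a)"])
      fix z assume "z \<in> D"
      then show "point_le z (a - 1, 1) \<or> point_le z (b, 0) \<or> point_le z (a, N - a) \<or> (\<forall>w\<in>D. point_le w z)"
        using cov[of z] top by fastforce
    qed (use b2 b1 L(3-5) b(1) D in auto)
  qed
  have critD: "critical D (b, 0) (a, N - a)"
  proof -
    have "(b, 0) \<in> D" "(a, N - a) \<in> D" "\<not> point_le (b, 0) (a, N - a)" "\<not> point_le (a, N - a) (b, 0)"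
      using D L(3-5) b ba b1 by auto
    moreover have "point_le z (b, 0) \<or> point_le z (a, N - a) \<or> z = (a, 0)" if "z \<in> D" for z
    proof -
      have "point_le (a - 1, 1) (b, 0)" using \<open>b + 1 = a\<close> by simp
      then show ?thesis using cov[OF that] point_le_trans point_le_refl by blast
    qed
    ultimately show ?thesis unfolding critical_def using top by blast
  qed
  \<comment> \<open>The plan is to compare the counts of points not below the two critical points of
    \<open>D\<close> with those in the poset of \<open>lowered M\<close>.\<close>
  define S where "S = not_below D (a, N - a)"
  have nd1: "card (not_below D (b, 0)) = 2"
  proof -
    have "not_below D (b, 0) = {(a, 0), (a, N - a)}"
    proof (intro Set.set_eqI iffI)
      fix z assume z: "z \<in> not_below D (b, 0)"
      then have "z \<in> D" "\<not> point_le z (b, 0)" by (auto simp: not_below_def)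
      moreover have "point_le (a - 1, 1) (b, 0)" using \<open>b + 1 = a\<close> by simp
      ultimately show "z \<in> {(a, 0), (a, N - a)}" using cov[of z] point_le_trans by blast
    qed (use D L(3-5) ba b1 in \<open>auto simp: not_below_def\<close>)
    then show ?thesis using L(5) by simp
  qed
  have gD: "point_iso g D (points (lowered M))" using g D_def by simp
  have mem: "(b, 0) \<in> D" "(a, N - a) \<in> D" using critD by (auto simp: critical_def)
  have nds: "card (not_below D (b, 0)) = card (not_below (points (lowered M)) (g (b, 0)))"
    "card S = card (not_below (points (lowered M)) (g (a, N - a)))"
    unfolding S_def using order_iso_card[OF point_iso_not_below[OF gD]] mem by blast+
  have a'0: "a' \<noteq> 0" using M' by metis
  then have "N' - 1 - (a' - 1) = card L" using cL M'(5) by simp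
  \<comment> \<open>The counts 2 and \<open>card S\<close> agree in some order with
    \<open>card (lowered M)\<close> and \<open>N' - a' = card L\<close>. Since \<open>card L\<close>
    is at least 3, the 2 must be \<open>card (lowered M)\<close>.\<close>
  then have "card (lowered M) = 2 \<and> card S = card L"
    using critical_point_iso_cases[OF gD critD P(1)] nds nd1 P(2,3) c3 by auto
  then have cpr: "card (lowered M) = 2" and cS: "card S = card L" by auto
  define one where "one = (if 1 \<in> L then 1 else 0 :: nat)"
  \<comment> \<open>As N - a \<ge> 2, no point with y \<le> 1 lies below \<open>(a, N - a)\<close>.
    Each exponent other than N gives such a point with y = 0, and one with y = 1 unless it is 1.
    With \<open>card S = card L\<close> this bounds \<open>card L\<close> by 3 and forces 1 into
    \<open>L\<close>.\<close>
  have "2 * (card L - 1) - one \<le> card S"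
  proof -
    have "(\<lambda>l. (l, 0)) ` (L - {N}) \<union> (\<lambda>l. (l - 1, 1)) ` (L - {N, 1}) \<subseteq> S"
    proof -
      have "l \<le> a" if "l \<in> L" "l \<noteq> N" for l using L(6) that by blast
      moreover have "l \<ge> 1" if "l \<in> L" for l using L(2) that by (cases l) auto
      moreover have "l \<ge> 2" if "l \<in> L" "l \<noteq> 1" for l
        using L(2) that by (cases l rule: nat.exhaust) (auto simp: Suc_le_eq intro!: gr0I)
      ultimately show ?thesis unfolding S_def not_below_def using L(5)
        by (fastforce simp: D)
    qed
    moreover have "finite S"
      unfolding S_def not_below_def D_def below_def using finite_points[OF L(1)] by simp
    ultimately have "card ((\<lambda>l. (l, 0 :: nat)) ` (L - {N}) \<union> (\<lambda>l. (l - 1, 1)) ` (L - {N, 1})) \<le> card S"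
      by (intro card_mono)
    moreover have "card ((\<lambda>l. (l, 0 :: nat)) ` (L - {N})) = card L - 1"
      using L by (subst card_image) (auto simp: inj_on_def)
    moreover have "card ((\<lambda>l. (l - 1, 1 :: nat)) ` (L - {N, 1})) = card L - 1 - one"
    proof -
      have "inj_on (\<lambda>l. (l - 1, 1 :: nat)) (L - {N, 1})"
      proof (rule inj_onI)
        fix x y assume "x \<in> L - {N, 1}" "y \<in> L - {N, 1}" "(x - 1, 1 :: nat) = (y - 1, 1)"
        moreover from this have "x \<noteq> 0" "y \<noteq> 0" using L(2) by (metis DiffD1)+
        ultimately show "x = y" by auto
      qed
      then have "card ((\<lambda>l. (l - 1, 1 :: nat)) ` (L - {N, 1})) = card (L - {N, 1})"
        by (rule card_image)
      also have "\<dots> = card L - 1 - one"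
      proof -
        have "N \<noteq> 1" using L(5) by simp
        have "L - {N, 1} = (L - {N}) - {1}" by blast
        then show ?thesis using L(1,3) \<open>N \<noteq> 1\<close> by (simp add: one_def card_Diff_singleton_if)
      qed
      finally show ?thesis .
    qed
    moreover have "(\<lambda>l. (l, 0 :: nat)) ` (L - {N}) \<inter> (\<lambda>l. (l - 1, 1)) ` (L - {N, 1}) = {}"
      by auto
    ultimately show ?thesis using L(1) by (simp add: card_Un_disjoint)
  qed
  moreover have "one \<le> 1" by (simp add: one_def)
  ultimately have three: "card L = 3" "one = 1" using cS c3 by linarith+
  have c3': "card {b, a, N} = 3" using ba L(5) by simp
  have "{b, a, N} \<subseteq> L" using b(1) L(3,4) by blast
  then have Leq: "L = {b, a, N}"
    by (rule card_subset_eq[OF L(1), symmetric]) (simp only: c3' three(1))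
  have "1 \<in> L"
  proof (rule ccontr)
    assume "1 \<notin> L"
    then have "one = 0" by (simp add: one_def)
    then show False using three(2) by simp
  qed
  then have "1 \<in> {b, a, N}" by (simp only: Leq)
  then have "b = 1" using ba b1 L(5) by auto
  moreover from this have "a = 2" "N = 2 + card M" using \<open>b + 1 = a\<close> cM L(5) by auto
  ultimately have Leq: "L = {1, 2, 2 + card M}" by (simp only: Leq)
  have cMpos: "card M \<ge> 2" using cM L(5) by simp
  then have sumL: "\<Sum>L = 5 + card M" using Leq by simp
  have N': "N' = a' + 3" using cL three(1) by simp
  \<comment> \<open>\<open>lowered M\<close> has two elements, so \<open>M\<close> is
    \<open>{a', a' + 3}\<close>, possibly with 1 added. Comparing sums gives a' = 2 both times: the
    exceptional pair in one case, \<open>L = M = {1, 2, 5}\<close> in the other.\<close>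
  show ?thesis
  proof (cases "1 \<in> M")
    case False
    then have "card M = 2" using card_lowered(1)[OF M'(1,2)] cpr by simp
    moreover have "{a', N'} \<subseteq> M" "card {a', N'} = 2" using M'(3,4) N' by auto
    ultimately have "M = {a', a' + 3}" using card_subset_eq[OF M'(1), of "{a', N'}"] N' by simp
    then have "M = {2, 5}" using sums sumL \<open>card M = 2\<close> by simp
    then show ?thesis using Leq \<open>card M = 2\<close> by (simp add: exceptional_def)
  next
    case True
    then have "card M = 3" using card_lowered(1)[OF M'(1,2)] cpr by simp
    moreover have "{1, a', N'} \<subseteq> M" "card {1, a', N'} = 3" using True M'(3,4) N' \<open>a' \<noteq> 1\<close> a'0 by auto
    ultimately have "M = {1, a', a' + 3}"
      using card_subset_eq[OF M'(1), of "{1, a', N'}"] N' by simp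
    then have "M = {1, 2, 5}" using sums sumL \<open>card M = 3\<close> \<open>a' \<noteq> 1\<close> a'0 by simp
    then show ?thesis using Leq \<open>card M = 3\<close> by simp
  qed
qed

text \<open>The poset of \<open>lowered M\<close> has a greatest point and a greatest one among the
  rest, because its two largest exponents are consecutive. If a - b \<ge> 2 and b > 1, then below
  \<open>(b, 0)\<close> there is no second greatest point: it would have to dominate both
  \<open>(b, a - b)\<close> and \<open>(b - 1, 1)\<close>, and only \<open>(b, 0)\<close> does so.
  For b = 1 there are too few points.\<close>

lemma narrow_top_swapped:
  assumes A: "narrow_top L a b" and M: "narrow_top M a' b'"
    and cM: "2 * (a - b) + 1 = card M"
    and g: "point_iso g (below (points L) (b, 0)) (points (lowered M))"
  shows "a = Suc b"
proof (rule ccontr)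
  assume "a \<noteq> Suc b"
  define D where "D = below (points L) (b, 0)"
  have L: "finite L" "0 \<notin> L" "Suc a \<in> L" "a \<in> L" "b \<in> L" "b < a"
    "\<And>l. l \<in> L \<Longrightarrow> l = Suc a \<or> l = a \<or> l \<le> b"
    using A by (auto simp: narrow_top_def)
  have M': "finite M" "0 \<notin> M" "Suc a' \<in> M" "a' \<in> M" "b' \<in> M" "b' < a'"
    "\<And>l. l \<in> M \<Longrightarrow> l = Suc a' \<or> l = a' \<or> l \<le> b'"
    using M by (auto simp: narrow_top_def)
  have ab: "a - b \<ge> 2" using L(6) \<open>a \<noteq> Suc b\<close> by simp
  have b: "b \<ge> 1" using L by (cases b) auto
  have b': "b' \<ge> 1" using M' by (cases b') auto
  have D: "(x, y) \<in> D \<longleftrightarrow> 1 \<le> x \<and> x \<le> b \<and> x + y \<in> L" for x y by (auto simp: D_def below_def)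
  obtain h where h: "point_iso h (points (lowered M)) D" using order_iso_inv[OF g] D_def by blast
  show False
  proof (cases "b = 1")
    case True
    \<comment> \<open>Here \<open>(b - 1, 1)\<close> is not a point, so counting replaces the
      argument: at most three points, while \<open>M\<close> has at least five exponents.\<close>
    have "D \<subseteq> {(1, 0), (1, a - 1), (1, a)}"
    proof
      fix z assume "z \<in> D"
      then obtain y where "z = (1, y)" "Suc y \<in> L" using D True by (cases z) (auto simp: le_antisym)
      then show "z \<in> {(1, 0), (1, a - 1), (1, a)}" using L(7)[of "Suc y"] True by auto
    qed
    then have "card D \<le> card {(1 :: nat, 0), (1, a - 1), (1, a)}" by (intro card_mono) auto
    also have "\<dots> \<le> 3" by (simp add: card_insert_if)
    finally have "card D \<le> 3" .
    moreover have "card (lowered M) \<le> card (points (lowered M))"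
    proof (rule card_inj_on_le)
      show "inj_on (\<lambda>l. (l, 0)) (lowered M)" by (simp add: inj_on_def)
      show "(\<lambda>l. (l, 0)) ` lowered M \<subseteq> points (lowered M)" by (auto simp: lowered_def)
      show "finite (points (lowered M))" using finite_points card_lowered(3)[OF M'(1,2)] by blast
    qed
    moreover have "card (lowered M) \<ge> 4"
      using card_lowered(1)[OF M'(1,2)] cM ab by (auto split: if_splits)
    ultimately show False using order_iso_card[OF h] by simp
  next
    case False
    define t w where "t = h (a', 0)" and "w = h (a' - 1, 0)"
    have mem: "(a', 0) \<in> points (lowered M)" "(a' - 1, 0) \<in> points (lowered M)"
      using M' b' by (auto simp: lowered_def)
    have pM: "point_le z (a', 0) \<and> (z = (a', 0) \<or> point_le z (a' - 1, 0))" if "z \<in> points (lowered M)" for z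
    proof (cases z)
      case (Pair x y)
      then have "1 \<le> x" "Suc (x + y) \<in> M" using that by (auto simp: lowered_def)
      then have "x + y \<le> a'" using M'(7)[of "Suc (x + y)"] M'(6) by auto
      then show ?thesis using Pair by auto
    qed
    have tw: "t \<in> D" "w \<in> D" "t \<noteq> w" and surj: "h ` points (lowered M) = D"
    proof -
      have "bij_betw (h) (points (lowered M)) D" using h by (simp add: order_iso_def)
      then show "t \<in> D" "w \<in> D" "t \<noteq> w" "h ` points (lowered M) = D"
        using mem M'(6) unfolding t_def w_def bij_betw_def inj_on_def by fastforce+
    qed
    have *: "point_le z t \<and> (z = t \<or> point_le z w)" if "z \<in> D" for z
    proof -
      obtain u where u: "u \<in> points (lowered M)" "z = h u"
        using \<open>z \<in> D\<close> surj by blast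
      then show ?thesis
        using pM[OF u(1)] order_iso_iff[OF h u(1) mem(1)] order_iso_iff[OF h u(1) mem(2)]
        unfolding t_def w_def by auto
    qed
    have B: "(b, 0) \<in> D" "(b, a - b) \<in> D" "(b - 1, 1) \<in> D"
      using b False L(4-6) by (simp_all add: D)
    have "t = (b, 0)" using *[OF B(1)] tw(1) by (cases t) (simp add: D)
    then have "point_le (b, a - b) w" "point_le (b - 1, 1) w"
      using *[OF B(2)] *[OF B(3)] ab b by auto
    then obtain x y where w: "w = (x, y)" "b \<le> x" "y \<le> a - b" "y \<le> 1"
      by (cases w) auto
    have "(x, y) \<in> D" using tw(2) w(1) by simp
    then have "x = b" "x + y \<in> L" using w(2) by (auto simp: D)
    \<comment> \<open>y = 1 would make b + 1 an exponent strictly between b and a.\<close>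
    then have "y = 0" using L(7)[of "x + y"] w ab by (cases y) auto
    then show False using tw(3) w \<open>x = b\<close> \<open>t = (b, 0)\<close> by simp
  qed
qed

lemma narrow_top_consecutive:
  assumes "narrow_top L (Suc b) b" "card L = 3"
  shows "L = {b, Suc b, Suc (Suc b)}"
proof -
  have "{b, Suc b, Suc (Suc b)} \<subseteq> L" "finite L" using assms(1) by (auto simp: narrow_top_def)
  moreover have "card {b, Suc b, Suc (Suc b)} = 3" by simp
  ultimately show ?thesis using assms(2) card_subset_eq[of L "{b, Suc b, Suc (Suc b)}"] by simp
qed

text \<open>Strong induction on the number of points. The induction hypothesis is applied only when
  the critical pairs are matched in order (\<open>straight\<close>); the swapped matching is closed
  by the two lemmas above and the equality of sums.\<close>

theorem point_iso_classification:
  assumes "point_iso f (points L) (points M)" "finite L" "finite M" "L \<noteq> {}" "M \<noteq> {}" "0 \<notin> L" "0 \<notin> M"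
  shows "L = M \<or> exceptional L M \<or> exceptional M L"
  using assms
proof (induction "card (points L)" arbitrary: f L M rule: less_induct)
  case less
  note f = less.prems(1)
  have fin: "finite L" "finite M" and z: "0 \<notin> L" "0 \<notin> M" using less.prems by auto
  have cp: "card (points L) = card (points M)" using order_iso_card[OF f] .
  then have sums: "\<Sum>L = \<Sum>M" using card_points fin by simp
  define g where "g = inv_into (points L) f"
  have g: "point_iso g (points M) (points L)" unfolding g_def using f by (rule order_iso_inv)
  have gf: "g (f x) = x" if "x \<in> points L" for x
    unfolding g_def using f that bij_betw_inv_into_left[of f "points L" "points M" x]
    by (simp add: order_iso_def)
  let ?chain = "\<lambda>A. \<forall>u\<in>A. \<forall>v\<in>A. point_le u v \<or> point_le v u"
  have chain: "?chain (points L) \<longleftrightarrow> ?chain (points M)"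
  proof -
    have "?chain B" if "point_iso f A B" "?chain A" for f A B
    proof -
      have "B = f ` A" using that(1) by (simp add: order_iso_def bij_betw_def)
      then show ?thesis using that order_iso_iff[OF that(1)] by auto
    qed
    then show ?thesis using f g by blast
  qed
  have straight: "L = M" if st: "same_type L M" and cLM: "card L = card M"
    and s: "f (N - 1, 1) = (N' - 1, 1)" "(N - 1, 1) \<in> points L"
    and N: "N \<in> L" "\<forall>l\<in>L. l \<le> N" "\<forall>l\<in>M. l \<le> N'" for N N'
  proof -
    have "point_iso f (below (points L) (N - 1, 1)) (below (points M) (N' - 1, 1))"
      using point_iso_below[OF f s(2)] s(1) by simp
    then obtain h where h: "point_iso h (points (lowered L)) (points (lowered M))"
      using point_iso_lowered[OF N(2)] point_iso_lowered[OF N(3)] order_iso_inv order_iso_comp by meson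
    \<comment> \<open>The greatest point is missing from the down-set, so the induction measure
      decreases.\<close>
    have "(N, 0) \<in> points L" "(N, 0) \<notin> below (points L) (N - 1, 1)"
      using N(1) z(1) by (cases N; auto simp: below_def)+
    moreover have "below (points L) (N - 1, 1) \<subseteq> points L" by (auto simp: below_def)
    ultimately have "below (points L) (N - 1, 1) \<subset> points L" by blast
    then have "card (below (points L) (N - 1, 1)) < card (points L)"
      using finite_points[OF fin(1)] psubset_card_mono by blast
    then have "card (points (lowered L)) < card (points L)"
      using order_iso_card[OF point_iso_lowered[OF N(2)]] by simp
    moreover have "lowered L \<noteq> {}" "lowered M \<noteq> {}" "0 \<notin> lowered L" "0 \<notin> lowered M"
    proof -
      show "0 \<notin> lowered L" "0 \<notin> lowered M" by (auto simp: lowered_def)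
      show "lowered L \<noteq> {}" using s(2) N(1) by (auto simp: lowered_def)
      then obtain l where "l \<in> lowered L" by blast
      then have "(l, 0) \<in> points (lowered L)" by (simp add: lowered_def)
      then have "points (lowered L) \<noteq> {}" by blast
      then show "lowered M \<noteq> {}" using h by (auto simp: order_iso_def bij_betw_def points_def)
    qed
    ultimately have "lowered L = lowered M \<or> exceptional (lowered L) (lowered M) \<or> exceptional (lowered M) (lowered L)"
      using less.hyps[OF _ h] card_lowered(3) fin z by blast
    moreover have "same_type M L" using st unfolding same_type_def by metis
    ultimately have "lowered L = lowered M" using not_exceptional_lowered st cLM by metis
    then show ?thesis using lowered_inject cLM fin z by blast
  qed
  have cards: "card (not_below (points L) x) = card (not_below (points M) (f x))" if "x \<in> points L" for x
    using order_iso_card[OF point_iso_not_below[OF f that]] .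
  show ?case
  proof (cases rule: top_cases[OF fin(1) less.prems(4) z(1)])
    case (1 N)
    have "?chain (points L)" unfolding 1 by (intro ballI chain_single)
    then have "?chain (points M)" using chain by blast
    then have nc: "\<not> critical (points M) s q" for s q using critical_not_chain by blast
    show ?thesis
    proof (cases rule: top_cases[OF fin(2) less.prems(5) z(2)])
      case M: (1 N')
      then show ?thesis using sums z unfolding 1 by (auto simp: exceptional_def)
    next
      case M: (2 a')
      then have "N = 2 * a' + 1" "a' \<ge> 1" using sums z unfolding 1 by auto
      then show ?thesis using M unfolding 1 exceptional_def by blast
    next
      case (3 N' a')
      then show ?thesis using nc wide_top_facts(1) by blast
    next
      case (4 a' b')
      then show ?thesis using nc narrow_top_facts(1) by blast
    qed
  next
    case (2 a)
    have "?chain (points L)" unfolding 2 by (intro ballI chain_pair)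
    then have "?chain (points M)" using chain by blast
    then have nc: "\<not> critical (points M) s q" for s q using critical_not_chain by blast
    show ?thesis
    proof (cases rule: top_cases[OF fin(2) less.prems(5) z(2)])
      case M: (1 N')
      then have "N' = 2 * a + 1" "a \<ge> 1" using sums z unfolding 2 by auto
      then show ?thesis using M unfolding 2 exceptional_def by blast
    next
      case M: (2 a')
      then have "a = a'" using sums unfolding 2 by simp
      then show ?thesis using M unfolding 2 by simp
    next
      case (3 N' a')
      then show ?thesis using nc wide_top_facts(1) by blast
    next
      case (4 a' b')
      then show ?thesis using nc narrow_top_facts(1) by blast
    qed
  next
    case (3 N a)
    note FL = wide_top_facts[OF 3]
    have nc: "\<not> ?chain (points M)" using chain critical_not_chain[OF FL(1)] by blast
    have mL: "(N - 1, 1) \<in> points L" "(a, 0) \<in> points L" using FL(1) by (auto simp: critical_def)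
    show ?thesis
    proof (cases rule: top_cases[OF fin(2) less.prems(5) z(2)])
      case (1 N)
      have "?chain (points M)" unfolding 1 by (intro ballI chain_single)
      then show ?thesis using nc by blast
    next
      case (2 a)
      have "?chain (points M)" unfolding 2 by (intro ballI chain_pair)
      then show ?thesis using nc by blast
    next
      case M: (3 N' a')
      note FM = wide_top_facts[OF M]
      from critical_point_iso_cases[OF f FL(1) FM(1)] show ?thesis
      proof
        assume s: "f (N - 1, 1) = (N' - 1, 1) \<and> f (a, 0) = (a', 0)"
        then have "card L = card M" "N - a = N' - a'"
          using cards[OF mL(1)] cards[OF mL(2)] FL(2,3) FM(2,3) by auto
        moreover from this have "same_type L M" using 3 M unfolding same_type_def by blast
        ultimately show ?thesis
          using straight[of N N'] s mL FL(5) FM(5) 3 by (auto simp: wide_top_def)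
      next
        assume s: "f (N - 1, 1) = (a', 0) \<and> f (a, 0) = (N' - 1, 1)"
        then have c: "card L = N' - a'" "N - a = card M"
          using cards[OF mL(1)] cards[OF mL(2)] FL(2,3) FM(2,3) by auto
        have "point_iso f (below (points L) (a, 0)) (below (points M) (N' - 1, 1))"
          using point_iso_below[OF f mL(2)] s by simp
        then obtain h where h: "point_iso h (below (points L) (a, 0)) (points (lowered M))"
          using point_iso_lowered[OF FM(5)] order_iso_comp by blast
        have "g (a', 0) = (N - 1, 1)" "(a', 0) \<in> points M"
          using gf[OF mL(1)] s FM(1) by (simp_all add: critical_def)
        then have "point_iso g (below (points M) (a', 0)) (below (points L) (N - 1, 1))"
          using point_iso_below[OF g] by metis
        then obtain h' where h': "point_iso h' (below (points M) (a', 0)) (points (lowered L))"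
          using point_iso_lowered[OF FL(5)] order_iso_comp by blast
        have "a + 2 \<le> N" "a' + 2 \<le> N'" using 3 M by (simp_all add: wide_top_def)
        then have "2 \<le> card L" "2 \<le> card M" using c by linarith+
        \<comment> \<open>The swapped case is treated from whichever side has three exponents. If
          both have two, both gaps are 2 and the sums decide.\<close>
        then consider "3 \<le> card L" | "3 \<le> card M" | "card L = 2" "card M = 2" by linarith
        then show ?thesis
        proof cases
          case 1
          then show ?thesis using wide_top_swapped[OF 3 M 1 c h sums] by blast
        next
          case 2
          then show ?thesis using wide_top_swapped[OF M 3 2 c(2)[symmetric] c(1)[symmetric] h' sums[symmetric]] by blast
        next
          case 3
          have "L = {a, N}" "M = {a', N'}" "N = a + 2" "N' = a' + 2"
          proof -
            show "N = a + 2" "N' = a' + 2" using c 3 by auto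
            then have "card {a, N} = card L" "card {a', N'} = card M" using 3 by auto
            then show "L = {a, N}" "M = {a', N'}"
              using \<open>wide_top L N a\<close> M fin card_subset_eq[of L "{a, N}"] card_subset_eq[of M "{a', N'}"]
              unfolding wide_top_def by auto
          qed
          then show ?thesis using sums by auto
        qed
      qed
    next
      case M: (4 a' b')
      note FM = narrow_top_facts[OF M]
      \<comment> \<open>A wide and a narrow top cannot match: the number of points below neither
        critical point would be both 1 and 2.\<close>
      have "card (not_below (points M) (f (N - 1, 1)) \<inter> not_below (points M) (f (a, 0))) = 1"
        using card_not_below_both[OF f mL] FL(4) by simp
      moreover have "not_below (points M) (f (N - 1, 1)) \<inter> not_below (points M) (f (a, 0)) =
          not_below (points M) (a', 1) \<inter> not_below (points M) (b', 0)"
        using critical_point_iso_cases[OF f FL(1) FM(1)] by auto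
      ultimately show ?thesis using FM(4) by simp
    qed
  next
    case (4 a b)
    note FL = narrow_top_facts[OF 4]
    have nc: "\<not> ?chain (points M)" using chain critical_not_chain[OF FL(1)] by blast
    have mL: "(a, 1) \<in> points L" "(b, 0) \<in> points L" using FL(1) by (auto simp: critical_def)
    show ?thesis
    proof (cases rule: top_cases[OF fin(2) less.prems(5) z(2)])
      case (1 N)
      have "?chain (points M)" unfolding 1 by (intro ballI chain_single)
      then show ?thesis using nc by blast
    next
      case (2 a)
      have "?chain (points M)" unfolding 2 by (intro ballI chain_pair)
      then show ?thesis using nc by blast
    next
      case M: (3 N' a')
      note FM = wide_top_facts[OF M]
      have "card (not_below (points M) (f (a, 1)) \<inter> not_below (points M) (f (b, 0))) = 2"
        using card_not_below_both[OF f mL] FL(4) by simp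
      moreover have "not_below (points M) (f (a, 1)) \<inter> not_below (points M) (f (b, 0)) =
          not_below (points M) (N' - 1, 1) \<inter> not_below (points M) (a', 0)"
        using critical_point_iso_cases[OF f FL(1) FM(1)] by auto
      ultimately show ?thesis using FM(4) by simp
    next
      case M: (4 a' b')
      note FM = narrow_top_facts[OF M]
      from critical_point_iso_cases[OF f FL(1) FM(1)] show ?thesis
      proof
        assume s: "f (a, 1) = (a', 1) \<and> f (b, 0) = (b', 0)"
        then have "card L = card M" using cards[OF mL(1)] FL(2) FM(2) by auto
        moreover have "same_type L M" using 4 M unfolding same_type_def by blast
        ultimately show ?thesis
          using straight[of "Suc a" "Suc a'"] s mL FL(5) FM(5) 4 by (auto simp: narrow_top_def)
      next
        assume s: "f (a, 1) = (b', 0) \<and> f (b, 0) = (a', 1)"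
        then have c: "card L = 2 * (a' - b') + 1" "2 * (a - b) + 1 = card M"
          using cards[OF mL(1)] cards[OF mL(2)] FL(2,3) FM(2,3) by auto
        have "point_iso f (below (points L) (b, 0)) (below (points M) (a', 1))"
          using point_iso_below[OF f mL(2)] s by simp
        then obtain h where h: "point_iso h (below (points L) (b, 0)) (points (lowered M))"
          using point_iso_lowered[OF FM(5)] order_iso_comp by fastforce
        have "g (b', 0) = (a, 1)" "(b', 0) \<in> points M"
          using gf[OF mL(1)] s FM(1) by (simp_all add: critical_def)
        then have "point_iso g (below (points M) (b', 0)) (below (points L) (a, 1))"
          using point_iso_below[OF g] by metis
        then obtain h' where h': "point_iso h' (below (points M) (b', 0)) (points (lowered L))"
          using point_iso_lowered[OF FL(5)] order_iso_comp by fastforce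
        \<comment> \<open>The swap forces three consecutive exponents on both sides, and their sum
          determines them.\<close>
        have ab: "a = Suc b" "a' = Suc b'"
          using narrow_top_swapped[OF 4 M c(2) h] narrow_top_swapped[OF M 4 c(1)[symmetric] h'] by auto
        then have "card L = 3" "card M = 3" using c by auto
        then have "L = {b, Suc b, Suc (Suc b)}" "M = {b', Suc b', Suc (Suc b')}"
          using narrow_top_consecutive 4 M ab by blast+
        then show ?thesis using sums by auto
      qed
    qed
  qed
qed

section \<open>The lattice of tuples and its join-primes\<close>

text \<open>Entries off \<open>L\<close> are fixed to 0 so that equality and order of functions are
  those of tuples. The last inequality bounds the increment by k - l without truncated
  subtraction.\<close>

definition tuples :: "nat set \<Rightarrow> (nat \<Rightarrow> nat) set" where
  "tuples L = {a. (\<forall>l\<in>L. a l \<le> l) \<and> (\<forall>l. l \<notin> L \<longrightarrow> a l = 0) \<and>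
     (\<forall>l\<in>L. \<forall>k\<in>L. l \<le> k \<longrightarrow> a l \<le> a k \<and> a k + l \<le> a l + k)}"

lemma tuplesD:
  assumes "a \<in> tuples L"
  shows "l \<in> L \<Longrightarrow> a l \<le> l" "l \<notin> L \<Longrightarrow> a l = 0"
    "l \<in> L \<Longrightarrow> k \<in> L \<Longrightarrow> l \<le> k \<Longrightarrow> a l \<le> a k"
    "l \<in> L \<Longrightarrow> k \<in> L \<Longrightarrow> l \<le> k \<Longrightarrow> a k + l \<le> a l + k"
  using assms by (auto simp: tuples_def)

lemma tuples_le_iff:
  assumes "a \<in> tuples L" "b \<in> tuples L"
  shows "a \<le> b \<longleftrightarrow> (\<forall>l\<in>L. a l \<le> b l)"
proof
  assume *: "\<forall>l\<in>L. a l \<le> b l"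
  show "a \<le> b"
  proof (rule le_funI)
    fix l show "a l \<le> b l" using * tuplesD(2)[OF assms(1)] by (cases "l \<in> L") auto
  qed
qed (simp add: le_fun_def)

text \<open>Primeness is phrased by a splitting of \<open>A\<close> into the up-set of
  \<open>j\<close> and the down-set of \<open>m\<close>. No join occurs, so invariance under order
  isomorphisms is immediate.\<close>

definition join_primes :: "('a \<Rightarrow> 'a \<Rightarrow> bool) \<Rightarrow> 'a set \<Rightarrow> 'a set" where
  "join_primes r A = {j \<in> A. \<exists>m\<in>A. \<forall>x\<in>A. r j x \<longleftrightarrow> \<not> r x m}"

lemma order_iso_join_primes:
  assumes f: "order_iso r r' f A B"
  shows "order_iso r r' f (join_primes r A) (join_primes r' B)"
  unfolding join_primes_def
proof (rule order_iso_restrict[OF f])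
  fix j assume j: "j \<in> A"
  have B: "B = f ` A" using f by (simp add: order_iso_def bij_betw_def)
  show "(\<exists>m\<in>A. \<forall>x\<in>A. r j x \<longleftrightarrow> \<not> r x m) \<longleftrightarrow>
      (\<exists>m\<in>B. \<forall>x\<in>B. r' (f j) x \<longleftrightarrow> \<not> r' x m)"
    unfolding B using order_iso_iff[OF f] j by simp
qed

text \<open>The least tuple with entry at least x at the exponent x + y: constant above that
  exponent, falling with slope 1 below it until it reaches 0.\<close>

definition jtuple :: "nat set \<Rightarrow> nat \<times> nat \<Rightarrow> nat \<Rightarrow> nat" where
  "jtuple L = (\<lambda>(x, y) k. if k \<in> L then x - (x + y - k) else 0)"

text \<open>The dual of \<open>jtuple\<close>: for x \<ge> 1, the greatest tuple with entry at most
  x - 1 at the exponent x + y.\<close>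

definition mtuple :: "nat set \<Rightarrow> nat \<times> nat \<Rightarrow> nat \<Rightarrow> nat" where
  "mtuple L = (\<lambda>(x, y) k. if k \<in> L then min (x - 1 + (k - (x + y))) k else 0)"

lemma jtuple_in: "jtuple L (x, y) \<in> tuples L"
  by (auto simp: tuples_def jtuple_def)

lemma mtuple_in: "mtuple L (x, y) \<in> tuples L"
  by (auto simp: tuples_def mtuple_def)

lemma jtuple_le_iff:
  assumes "a \<in> tuples L" "x + y \<in> L"
  shows "jtuple L (x, y) \<le> a \<longleftrightarrow> x \<le> a (x + y)"
proof
  assume "jtuple L (x, y) \<le> a"
  then have "jtuple L (x, y) (x + y) \<le> a (x + y)" by (rule le_funD)
  then show "x \<le> a (x + y)" using assms(2) by (simp add: jtuple_def)
next
  assume x: "x \<le> a (x + y)"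
  have "jtuple L (x, y) k \<le> a k" if "k \<in> L" for k
    using tuplesD(3)[OF assms(1) assms(2) that] tuplesD(4)[OF assms(1) that assms(2)] x that
    by (cases "x + y \<le> k") (auto simp: jtuple_def)
  then show "jtuple L (x, y) \<le> a" using tuples_le_iff[OF jtuple_in assms(1)] by blast
qed

lemma le_mtuple_iff:
  assumes "a \<in> tuples L" "x + y \<in> L"
  shows "a \<le> mtuple L (x, y) \<longleftrightarrow> a (x + y) \<le> x - 1"
proof
  assume "a \<le> mtuple L (x, y)"
  then have "a (x + y) \<le> mtuple L (x, y) (x + y)" by (rule le_funD)
  then show "a (x + y) \<le> x - 1" using assms(2) by (simp add: mtuple_def)
next
  assume x: "a (x + y) \<le> x - 1"
  have "a k \<le> mtuple L (x, y) k" if "k \<in> L" for k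
    using tuplesD(4)[OF assms(1) assms(2) that] tuplesD(3)[OF assms(1) that assms(2)]
      tuplesD(1)[OF assms(1) that] x that
    by (cases "x + y \<le> k") (auto simp: mtuple_def)
  then show "a \<le> mtuple L (x, y)" using tuples_le_iff[OF assms(1) mtuple_in] by blast
qed

lemma join_primes_tuples: "join_primes (\<le>) (tuples L) = jtuple L ` points L"
proof (intro Set.set_eqI iffI)
  fix j assume "j \<in> jtuple L ` points L"
  then obtain x y where j: "j = jtuple L (x, y)" "1 \<le> x" "x + y \<in> L" by (auto simp: points_def)
  have "j \<le> a \<longleftrightarrow> \<not> a \<le> mtuple L (x, y)" if "a \<in> tuples L" for a
    using jtuple_le_iff[OF that j(3)] le_mtuple_iff[OF that j(3)] j(1,2) by auto
  then show "j \<in> join_primes (\<le>) (tuples L)"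
    unfolding join_primes_def using jtuple_in mtuple_in j(1) by blast
next
  fix j assume "j \<in> join_primes (\<le>) (tuples L)"
  then obtain m where jm: "j \<in> tuples L" "m \<in> tuples L"
    "\<And>a. a \<in> tuples L \<Longrightarrow> j \<le> a \<longleftrightarrow> \<not> a \<le> m"
    by (auto simp: join_primes_def)
  have "\<not> j \<le> m" using jm(1,3) by blast
  then obtain k where k: "k \<in> L" "m k < j k"
    using tuples_le_iff[OF jm(1,2)] by (auto simp: not_le)
  \<comment> \<open>The witness sits at an exponent where \<open>j\<close> exceeds \<open>m\<close>,
    with the least entry exceeding \<open>m k\<close>. Its tuple is below \<open>j\<close> but not
    below \<open>m\<close>, hence also above \<open>j\<close>.\<close>
  define x y where "x = m k + 1" and "y = k - x"
  have xy: "x + y = k" "x \<ge> 1" using k(2) tuplesD(1)[OF jm(1) k(1)] by (auto simp: x_def y_def)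
  have "jtuple L (x, y) \<le> j" using jtuple_le_iff[OF jm(1)] xy k by (simp add: x_def)
  moreover have "\<not> jtuple L (x, y) \<le> m" using jtuple_le_iff[OF jm(2)] xy k by (simp add: x_def)
  then have "j \<le> jtuple L (x, y)" using jm(3) jtuple_in by blast
  ultimately have "j = jtuple L (x, y)" by (rule antisym[rotated])
  then show "j \<in> jtuple L ` points L" using xy k(1) by (intro image_eqI) auto
qed

lemma order_iso_jtuple: "order_iso point_le (\<le>) (jtuple L) (points L) (join_primes (\<le>) (tuples L))"
proof -
  have le: "point_le z w \<longleftrightarrow> jtuple L z \<le> jtuple L w" if "z \<in> points L" "w \<in> points L" for z w
  proof -
    obtain x y x' y' where zw: "z = (x, y)" "w = (x', y')" by (cases z, cases w) auto
    then have "1 \<le> x" "x + y \<in> L" using that by auto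
    then show ?thesis using jtuple_le_iff[OF jtuple_in, of x y L x' y'] unfolding zw
      by (auto simp: jtuple_def)
  qed
  have "inj_on (jtuple L) (points L)"
    by (rule inj_onI) (metis le point_le_antisym order_refl)
  then show ?thesis
    unfolding order_iso_def join_primes_tuples bij_betw_def using le by blast
qed

lemma tuples_iso_imp_point_iso:
  assumes "order_iso (\<le>) (\<le>) f (tuples L) (tuples M)"
  obtains g where "point_iso g (points L) (points M)"
  using order_iso_comp[OF order_iso_comp[OF order_iso_jtuple order_iso_join_primes[OF assms]]
      order_iso_inv[OF order_iso_jtuple]] that by blast

section \<open>The isomorphisms of the exceptional pairs\<close>

lemma tuples_chain_iso:
  assumes "k \<ge> 1"
  obtains f where "order_iso (\<le>) (\<le>) f (tuples {k, Suc k}) (tuples {2 * k + 1})"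
proof -
  \<comment> \<open>Both lattices are chains: the second entry equals the first or its successor, so
    the sum, running from 0 to 2k + 1, determines the tuple. The inverse splits it into rounded
    halves.\<close>
  let ?f = "\<lambda>a l. if l = 2 * k + 1 then a k + a (Suc k) else (0::nat)"
  let ?g = "\<lambda>b l. if l = k then b (2 * k + 1) div 2
    else if l = Suc k then (b (2 * k + 1) + 1) div 2 else (0::nat)"
  have a: "a \<in> tuples {k, Suc k} \<longleftrightarrow> a k \<le> k \<and> a k \<le> a (Suc k) \<and> a (Suc k) \<le> Suc (a k) \<and>
      (\<forall>l. l \<noteq> k \<and> l \<noteq> Suc k \<longrightarrow> a l = 0)" for a
    by (auto simp: tuples_def)
  have b: "b \<in> tuples {2 * k + 1} \<longleftrightarrow> b (2 * k + 1) \<le> 2 * k + 1 \<and> (\<forall>l. l \<noteq> 2 * k + 1 \<longrightarrow> b l = 0)" for b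
    by (auto simp: tuples_def)
  have "bij_betw ?f (tuples {k, Suc k}) (tuples {2 * k + 1})"
  proof (rule bij_betw_byWitness[where f' = ?g]; intro ballI subsetI)
    fix x assume "x \<in> tuples {k, Suc k}"
    then have x: "x k \<le> k" "x (Suc k) = x k \<or> x (Suc k) = Suc (x k)"
      "\<And>l. l \<noteq> k \<Longrightarrow> l \<noteq> Suc k \<Longrightarrow> x l = 0"
      unfolding a by auto
    show "?g (?f x) = x"
    proof
      fix l show "?g (?f x) l = x l" using x(2) x(3)[of l] by auto
    qed
  next
    fix x assume x: "x \<in> tuples {2 * k + 1}"
    show "?f (?g x) = x"
    proof
      fix l
      have "n div 2 + (n + 1) div 2 = n" for n :: nat by presburger
      then show "?f (?g x) l = x l" using x unfolding b by auto
    qed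
  next
    fix y assume "y \<in> ?f ` tuples {k, Suc k}"
    then show "y \<in> tuples {2 * k + 1}" unfolding b by (auto simp: a)
  next
    fix y assume "y \<in> ?g ` tuples {2 * k + 1}"
    then obtain b' where y: "y = ?g b'" and "b' \<in> tuples {2 * k + 1}" by blast
    then have "b' (2 * k + 1) \<le> 2 * k + 1" unfolding b by blast
    then show "y \<in> tuples {k, Suc k}" unfolding a y by auto
  qed
  moreover have "x \<le> y \<longleftrightarrow> ?f x \<le> ?f y" if "x \<in> tuples {k, Suc k}" "y \<in> tuples {k, Suc k}" for x y
  proof -
    have "x \<le> y \<longleftrightarrow> x k \<le> y k \<and> x (Suc k) \<le> y (Suc k)"
      unfolding tuples_le_iff[OF that] by simp
    moreover have "?f x \<le> ?f y \<longleftrightarrow> x k + x (Suc k) \<le> y k + y (Suc k)"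
      by (auto simp: le_fun_def)
    ultimately show ?thesis using that unfolding a by auto
  qed
  ultimately show ?thesis using that unfolding order_iso_def by blast
qed

text \<open>The isomorphism of the posets of join-primes matches the chain of the five points
  \<open>(x, 5 - x)\<close> with \<open>(1, 3) < (1, 1) < (1, 0) < (2, 0) < (4, 0)\<close>, and
  \<open>(1, 1) < (2, 0)\<close> with \<open>(2, 2) < (3, 1)\<close>; tuples count points in columns.\<close>
lemma tuples_124_iso:
  obtains f where "order_iso (\<le>) (\<le>) f (tuples {1, 2, 4}) (tuples {2, 5})"
proof -
  let ?b = "\<lambda>P. if P then 1 else 0 :: nat"
  \<comment> \<open>The point (x, y) is counted when x \<le> a (x + y); \<open>a 1\<close> and
    \<open>a 2\<close> count all the points of their exponents at once.\<close>
  let ?f = "\<lambda>(a :: nat \<Rightarrow> nat) (l :: nat). if l = 5 then ?b (1 \<le> a 4) + a 1 + a 2 + ?b (4 \<le> a 4)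
    else if l = 2 then ?b (2 \<le> a 4) + ?b (3 \<le> a 4) else (0::nat)"
  let ?g = "\<lambda>(b :: nat \<Rightarrow> nat) (l :: nat). if l = 4 then ?b (1 \<le> b 5) + b 2 + ?b (5 \<le> b 5)
    else if l = 2 then ?b (2 \<le> b 5) + ?b (4 \<le> b 5)
    else if l = 1 then ?b (3 \<le> b 5) else (0::nat)"
  have a: "a \<in> tuples {1, 2, 4} \<longleftrightarrow> a 1 \<le> 1 \<and> a 1 \<le> a 2 \<and> a 2 \<le> a 1 + 1 \<and> a 2 \<le> a 4 \<and> a 4 \<le> a 2 + 2 \<and>
      (\<forall>l. l \<noteq> 1 \<and> l \<noteq> 2 \<and> l \<noteq> 4 \<longrightarrow> a l = 0)" for a
    by (auto simp: tuples_def)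
  have b: "b \<in> tuples {2, 5} \<longleftrightarrow> b 2 \<le> 2 \<and> b 2 \<le> b 5 \<and> b 5 \<le> b 2 + 3 \<and>
      (\<forall>l. l \<noteq> 2 \<and> l \<noteq> 5 \<longrightarrow> b l = 0)" for b
    by (auto simp: tuples_def)
  have "bij_betw ?f (tuples {1, 2, 4}) (tuples {2, 5})"
  proof (rule bij_betw_byWitness[where f' = ?g]; intro ballI subsetI)
    fix x assume "x \<in> tuples {1, 2, 4}"
    then have x: "x 1 \<le> 1" "x 1 \<le> x 2" "x 2 \<le> x 1 + 1" "x 2 \<le> x 4" "x 4 \<le> x 2 + 2"
      "\<And>l. l \<noteq> 1 \<Longrightarrow> l \<noteq> 2 \<Longrightarrow> l \<noteq> 4 \<Longrightarrow> x l = 0"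
      unfolding a by auto
    show "?g (?f x) = x"
    proof
      fix l show "?g (?f x) l = x l" using x(1-5) x(6)[of l] by auto
    qed
  next
    fix x assume "x \<in> tuples {2, 5}"
    then have x: "x 2 \<le> 2" "x 2 \<le> x 5" "x 5 \<le> x 2 + 3" "\<And>l. l \<noteq> 2 \<Longrightarrow> l \<noteq> 5 \<Longrightarrow> x l = 0"
      unfolding b by auto
    show "?f (?g x) = x"
    proof
      fix l show "?f (?g x) l = x l" using x(1-3) x(4)[of l] by auto
    qed
  next
    fix y assume "y \<in> ?f ` tuples {1, 2, 4}"
    then obtain x where y: "y = ?f x" and "x \<in> tuples {1, 2, 4}" by blast
    then have "x 1 \<le> 1" "x 1 \<le> x 2" "x 2 \<le> x 1 + 1" "x 2 \<le> x 4" "x 4 \<le> x 2 + 2"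
      unfolding a by auto
    then show "y \<in> tuples {2, 5}" unfolding b y by auto
  next
    fix y assume "y \<in> ?g ` tuples {2, 5}"
    then obtain x where y: "y = ?g x" and "x \<in> tuples {2, 5}" by blast
    then have "x 2 \<le> 2" "x 2 \<le> x 5" "x 5 \<le> x 2 + 3" unfolding b by auto
    then show "y \<in> tuples {1, 2, 4}" unfolding a y by auto
  qed
  moreover have "x \<le> y \<longleftrightarrow> ?f x \<le> ?f y" if "x \<in> tuples {1, 2, 4}" "y \<in> tuples {1, 2, 4}" for x y
  proof -
    have le: "x \<le> y \<longleftrightarrow> x 1 \<le> y 1 \<and> x 2 \<le> y 2 \<and> x 4 \<le> y 4"
      unfolding tuples_le_iff[OF that] by simp
    have le': "?f x \<le> ?f y \<longleftrightarrow> ?f x 5 \<le> ?f y 5 \<and> ?f x 2 \<le> ?f y 2"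
      by (auto simp: le_fun_def)
    have x: "x 1 \<le> 1" "x 1 \<le> x 2" "x 2 \<le> x 1 + 1" "x 2 \<le> x 4" "x 4 \<le> x 2 + 2"
      "y 1 \<le> 1" "y 1 \<le> y 2" "y 2 \<le> y 1 + 1" "y 2 \<le> y 4" "y 4 \<le> y 2 + 2"
      using that unfolding a by auto
    show ?thesis unfolding le le' using x by (simp split: if_splits) arith
  qed
  ultimately show ?thesis using that unfolding order_iso_def by blast
qed

section \<open>Characteristic subgroups\<close>

lemma mem_cyc_prod:
  "x \<in> carrier (cyc_prod p ls) \<longleftrightarrow> length x = length ls \<and> (\<forall>i<length ls. x ! i < p ^ (ls ! i))"
  by (simp add: cyc_prod_def)

lemma cyc_prod_mult_nth:
  "i < length ls \<Longrightarrow> (x \<otimes>\<^bsub>cyc_prod p ls\<^esub> y) ! i = (x ! i + y ! i) mod p ^ (ls ! i)"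
  by (simp add: cyc_prod_def)

lemma length_cyc_prod_mult: "length (x \<otimes>\<^bsub>cyc_prod p ls\<^esub> y) = length ls"
  by (simp add: cyc_prod_def)

lemma cyc_prod_one: "\<one>\<^bsub>cyc_prod p ls\<^esub> = replicate (length ls) 0"
  by (simp add: cyc_prod_def)

lemma cyc_prod_eqI:
  "x \<in> carrier (cyc_prod p ls) \<Longrightarrow> y \<in> carrier (cyc_prod p ls) \<Longrightarrow>
    (\<And>i. i < length ls \<Longrightarrow> x ! i = y ! i) \<Longrightarrow> x = y"
  by (auto simp: mem_cyc_prod intro: nth_equalityI)

lemma cyc_prod_neg_mod:
  fixes x P :: nat
  assumes "x < P"
  shows "((P - x) mod P + x) mod P = 0"
proof -
  have "((P - x) mod P + x) mod P = (P - x + x) mod P" by (simp add: mod_add_left_eq)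
  then show ?thesis using assms by simp
qed

lemma comm_group_cyc_prod:
  assumes "p > 0"
  shows "comm_group (cyc_prod p ls)" (is "comm_group ?G")
proof (rule comm_groupI)
  fix x y z
  have closed: "u \<otimes>\<^bsub>?G\<^esub> v \<in> carrier ?G" for u v
    using assms by (simp add: mem_cyc_prod length_cyc_prod_mult cyc_prod_mult_nth)
  show "x \<otimes>\<^bsub>?G\<^esub> y \<in> carrier ?G" by (rule closed)
  show one: "\<one>\<^bsub>?G\<^esub> \<in> carrier ?G"
    using assms by (simp add: mem_cyc_prod cyc_prod_one)
  show "x \<otimes>\<^bsub>?G\<^esub> y \<otimes>\<^bsub>?G\<^esub> z = x \<otimes>\<^bsub>?G\<^esub> (y \<otimes>\<^bsub>?G\<^esub> z)"
    by (rule cyc_prod_eqI[OF closed closed])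
      (simp add: cyc_prod_mult_nth mod_add_left_eq mod_add_right_eq add.assoc)
  show "x \<otimes>\<^bsub>?G\<^esub> y = y \<otimes>\<^bsub>?G\<^esub> x"
    by (rule cyc_prod_eqI[OF closed closed]) (simp add: cyc_prod_mult_nth add.commute)
  assume x: "x \<in> carrier ?G"
  show "\<one>\<^bsub>?G\<^esub> \<otimes>\<^bsub>?G\<^esub> x = x"
    using x by (intro cyc_prod_eqI[OF closed]) (auto simp: cyc_prod_mult_nth cyc_prod_one mem_cyc_prod)
  \<comment> \<open>The outer reduction matters for a zero coordinate, whose difference would be out
    of range.\<close>
  let ?y = "map (\<lambda>i. (p ^ (ls ! i) - x ! i) mod p ^ (ls ! i)) [0..<length ls]"
  show "\<exists>y\<in>carrier ?G. y \<otimes>\<^bsub>?G\<^esub> x = \<one>\<^bsub>?G\<^esub>"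
  proof
    show "?y \<in> carrier ?G" using assms by (simp add: mem_cyc_prod)
    show "?y \<otimes>\<^bsub>?G\<^esub> x = \<one>\<^bsub>?G\<^esub>"
      using x by (intro cyc_prod_eqI[OF closed one])
        (simp add: cyc_prod_mult_nth cyc_prod_one mem_cyc_prod cyc_prod_neg_mod)
  qed
qed

lemma finite_cyc_prod: "finite (carrier (cyc_prod p ls))"
proof (rule finite_subset)
  show "finite {xs. set xs \<subseteq> (\<Union>l\<in>set ls. {..<p ^ l}) \<and> length xs = length ls}"
    by (rule finite_lists_length_eq) simp
  show "carrier (cyc_prod p ls) \<subseteq> {xs. set xs \<subseteq> (\<Union>l\<in>set ls. {..<p ^ l}) \<and> length xs = length ls}"
    by (force simp: mem_cyc_prod in_set_conv_nth)
qed

lemma cyc_prod_pow_nth: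
  assumes "i < length ls"
  shows "(x [^]\<^bsub>cyc_prod p ls\<^esub> (k :: nat)) ! i = k * x ! i mod p ^ (ls ! i)"
proof (induction k)
  case (Suc k)
  then show ?case
    using assms by (simp add: cyc_prod_mult_nth mod_add_left_eq mod_add_right_eq add.commute)
qed (use assms in \<open>simp add: cyc_prod_one\<close>)

section \<open>Tuples give characteristic subgroups\<close>

lemma characteristic_if_invariant:
  assumes "group G" "finite (carrier G)" "subgroup H G"
    and "\<And>\<phi>. \<phi> \<in> iso G G \<Longrightarrow> \<phi> ` H \<subseteq> H"
  shows "characteristic H G"
proof -
  have "\<phi> ` H = H" if "\<phi> \<in> iso G G" for \<phi>
  proof (rule endo_inj_surj)
    show "finite H" using assms(2,3) by (meson finite_subset subgroup.subset)
    show "\<phi> ` H \<subseteq> H" using assms(4) that .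
    show "inj_on \<phi> H"
      using that subgroup.subset[OF assms(3)] by (auto simp: iso_def bij_betw_def intro: inj_on_subset)
  qed
  then show ?thesis using assms(3) by (simp add: characteristic_def)
qed

text \<open>The multiples of p^(l - a l) form the subgroup of order p^(a l) in the factor of order
  p^l. Recording orders makes inclusion the pointwise order.\<close>

definition char_subgroup :: "nat \<Rightarrow> nat list \<Rightarrow> (nat \<Rightarrow> nat) \<Rightarrow> nat list set" where
  "char_subgroup p ls a =
    {x \<in> carrier (cyc_prod p ls). \<forall>i<length ls. p ^ (ls ! i - a (ls ! i)) dvd x ! i}"

text \<open>The membership condition in terms of the group structure alone, which shows invariance
  under automorphisms.\<close>
lemma char_subgroup_iff:
  assumes p: "p > 0" and ls: "sorted_wrt (<) ls" and a: "a \<in> tuples (set ls)"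
  shows "x \<in> char_subgroup p ls a \<longleftrightarrow> x \<in> carrier (cyc_prod p ls) \<and>
    (\<forall>i<length ls. \<exists>w\<in>carrier (cyc_prod p ls).
      x [^]\<^bsub>cyc_prod p ls\<^esub> (p ^ a (ls ! i)) = w [^]\<^bsub>cyc_prod p ls\<^esub> (p ^ (ls ! i)))"
    (is "_ \<longleftrightarrow> _ \<and> (\<forall>i<_. \<exists>w\<in>carrier ?G. _)")
proof -
  interpret G: comm_group ?G using comm_group_cyc_prod p by blast
  have al: "a (ls ! i) \<le> ls ! i" if "i < length ls" for i
    using tuplesD(1)[OF a] that by simp
  have "p ^ (ls ! i - a (ls ! i)) dvd x ! i" if "x \<in> carrier ?G" "i < length ls" "w \<in> carrier ?G"
    "x [^]\<^bsub>?G\<^esub> (p ^ a (ls ! i)) = w [^]\<^bsub>?G\<^esub> (p ^ (ls ! i))" for i w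
  proof -
    \<comment> \<open>Only coordinate i is inspected; there the power of \<open>w\<close>
      vanishes.\<close>
    have "p ^ a (ls ! i) * x ! i mod p ^ (ls ! i) = p ^ (ls ! i) * w ! i mod p ^ (ls ! i)"
      using arg_cong[OF that(4), of "\<lambda>x. x ! i"] cyc_prod_pow_nth[OF that(2)] by simp
    then have "p ^ (ls ! i) dvd p ^ a (ls ! i) * x ! i" by (simp add: mod_0_imp_dvd)
    moreover have "p ^ (ls ! i) = p ^ a (ls ! i) * p ^ (ls ! i - a (ls ! i))"
      using al[OF that(2)] by (simp flip: power_add)
    ultimately show ?thesis using p by simp
  qed
  moreover have "\<exists>w\<in>carrier ?G. x [^]\<^bsub>?G\<^esub> (p ^ a (ls ! i)) = w [^]\<^bsub>?G\<^esub> (p ^ (ls ! i))"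
    if x: "x \<in> char_subgroup p ls a" and i: "i < length ls" for i
  proof
    \<comment> \<open>For j \<le> i monotonicity of \<open>a\<close> makes p^(a (ls ! i)) kill x !
      j, so 0 will do. For j > i the bound on increments makes x ! j divisible by the missing power
      of p.\<close>
    let ?w = "map (\<lambda>j. if j \<le> i then 0 else x ! j div p ^ (ls ! i - a (ls ! i))) [0..<length ls]"
    have xc: "x \<in> carrier ?G" and xd: "\<And>j. j < length ls \<Longrightarrow> p ^ (ls ! j - a (ls ! j)) dvd x ! j"
      using x by (auto simp: char_subgroup_def)
    show w: "?w \<in> carrier ?G"
      using xc p by (auto simp: mem_cyc_prod intro: le_less_trans[OF div_le_dividend])
    show "x [^]\<^bsub>?G\<^esub> (p ^ a (ls ! i)) = ?w [^]\<^bsub>?G\<^esub> (p ^ (ls ! i))"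
    proof (rule cyc_prod_eqI)
      show "x [^]\<^bsub>?G\<^esub> (p ^ a (ls ! i)) \<in> carrier ?G" "?w [^]\<^bsub>?G\<^esub> (p ^ (ls ! i)) \<in> carrier ?G"
        using xc w by simp_all
      fix j assume j: "j < length ls"
      show "(x [^]\<^bsub>?G\<^esub> (p ^ a (ls ! i))) ! j = (?w [^]\<^bsub>?G\<^esub> (p ^ (ls ! i))) ! j"
      proof (cases "j \<le> i")
        case True
        then have "ls ! j \<le> ls ! i" using sorted_wrt_nth_less[OF ls, of j i] i by (cases "j = i") auto
        then have "a (ls ! j) \<le> a (ls ! i)" using tuplesD(3)[OF a] i j by simp
        then have "p ^ (ls ! j) dvd p ^ a (ls ! i) * p ^ (ls ! j - a (ls ! j))"
          unfolding power_add[symmetric] by (intro le_imp_power_dvd) simp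
        also have "\<dots> dvd p ^ a (ls ! i) * x ! j" using xd[OF j] by (rule mult_dvd_mono[OF dvd_refl])
        finally show ?thesis using True j by (simp add: cyc_prod_pow_nth)
      next
        case False
        then have "ls ! i < ls ! j" using sorted_wrt_nth_less[OF ls, of i j] j by simp
        then have "a (ls ! j) + ls ! i \<le> a (ls ! i) + ls ! j" using tuplesD(4)[OF a] i j by simp
        then have "p ^ (ls ! i - a (ls ! i)) dvd p ^ (ls ! j - a (ls ! j))"
          using al[OF i] al[OF j] by (intro le_imp_power_dvd) simp
        then have "p ^ (ls ! i - a (ls ! i)) dvd x ! j" using xd[OF j] by (rule dvd_trans)
        moreover have "p ^ (ls ! i) = p ^ a (ls ! i) * p ^ (ls ! i - a (ls ! i))"
          using al[OF i] by (simp flip: power_add)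
        ultimately show ?thesis using False j by (simp add: cyc_prod_pow_nth mult.assoc)
      qed
    qed
  qed
  ultimately show ?thesis unfolding char_subgroup_def by blast
qed

text \<open>An automorphism commutes with powers, so it carries the witnesses of
  \<open>char_subgroup_iff\<close> for an element to witnesses for its image.\<close>

lemma characteristic_char_subgroup:
  assumes p: "p > 0" and ls: "sorted_wrt (<) ls" and a: "a \<in> tuples (set ls)"
  shows "characteristic (char_subgroup p ls a) (cyc_prod p ls)" (is "characteristic ?H ?G")
proof (rule characteristic_if_invariant)
  interpret G: comm_group ?G using comm_group_cyc_prod p by blast
  show "group ?G" "finite (carrier ?G)" by (fact G.group_axioms finite_cyc_prod)+
  show "subgroup ?H ?G"
  proof (rule G.subgroupI)
    show "?H \<subseteq> carrier ?G" by (auto simp: char_subgroup_def)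
    have "\<one>\<^bsub>?G\<^esub> \<in> ?H" using G.one_closed by (auto simp: char_subgroup_def cyc_prod_one)
    then show "?H \<noteq> {}" by blast
    show mult: "x \<otimes>\<^bsub>?G\<^esub> y \<in> ?H" if "x \<in> ?H" "y \<in> ?H" for x y
      using that G.m_closed[of x y]
      by (auto simp: char_subgroup_def cyc_prod_mult_nth dvd_mod_iff le_imp_power_dvd)
    show "inv\<^bsub>?G\<^esub> x \<in> ?H" if x: "x \<in> ?H" for x
    proof -
      have xc: "x \<in> carrier ?G" using x by (simp add: char_subgroup_def)
      have "p ^ (ls ! i - a (ls ! i)) dvd (inv\<^bsub>?G\<^esub> x) ! i" if i: "i < length ls" for i
      proof -
        have "((inv\<^bsub>?G\<^esub> x) ! i + x ! i) mod p ^ (ls ! i) = 0"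
          using arg_cong[OF G.l_inv[OF xc], of "\<lambda>x. x ! i"] i
          by (simp add: cyc_prod_mult_nth cyc_prod_one)
        then have "p ^ (ls ! i - a (ls ! i)) dvd (inv\<^bsub>?G\<^esub> x) ! i + x ! i"
          by (meson diff_le_self dvd_trans le_imp_power_dvd mod_0_imp_dvd)
        then show ?thesis using x i by (simp add: char_subgroup_def dvd_add_left_iff)
      qed
      then show ?thesis using xc by (simp add: char_subgroup_def)
    qed
  qed
  show "\<phi> ` ?H \<subseteq> ?H" if "\<phi> \<in> iso ?G ?G" for \<phi>
  proof
    interpret \<phi>: group_hom ?G ?G \<phi> using that by unfold_locales (simp add: iso_def)
    fix y assume "y \<in> \<phi> ` ?H"
    then obtain x where x: "x \<in> ?H" "y = \<phi> x" by blast
    note xc = conjunct1[OF x(1)[unfolded char_subgroup_iff[OF assms]]]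
    have "\<exists>w\<in>carrier ?G. y [^]\<^bsub>?G\<^esub> (p ^ a (ls ! i)) = w [^]\<^bsub>?G\<^esub> (p ^ (ls ! i))"
      if i: "i < length ls" for i
    proof -
      obtain w where w: "w \<in> carrier ?G"
        "x [^]\<^bsub>?G\<^esub> (p ^ a (ls ! i)) = w [^]\<^bsub>?G\<^esub> (p ^ (ls ! i))"
        using conjunct2[OF x(1)[unfolded char_subgroup_iff[OF assms]]] i by blast
      then have "y [^]\<^bsub>?G\<^esub> (p ^ a (ls ! i)) = \<phi> w [^]\<^bsub>?G\<^esub> (p ^ (ls ! i))"
        using \<phi>.hom_nat_pow[OF xc, of "p ^ a (ls ! i)"] \<phi>.hom_nat_pow[OF w(1), of "p ^ (ls ! i)"]
        unfolding x(2) by (simp only:)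
      then show ?thesis using \<phi>.hom_closed[OF w(1)] by blast
    qed
    then show "y \<in> ?H" unfolding char_subgroup_iff[OF assms] using xc x(2) by simp
  qed
qed

section \<open>Unit vectors, transvections, and the converse\<close>

definition unit_vec :: "nat list \<Rightarrow> nat \<Rightarrow> nat \<Rightarrow> nat list" where
  "unit_vec ls i u = (replicate (length ls) 0)[i := u]"

lemma unit_vec_in:
  "p > 0 \<Longrightarrow> i < length ls \<Longrightarrow> u < p ^ (ls ! i) \<Longrightarrow> unit_vec ls i u \<in> carrier (cyc_prod p ls)"
  by (auto simp: mem_cyc_prod unit_vec_def nth_list_update)

lemma unit_vec_nth:
  "j < length ls \<Longrightarrow> unit_vec ls i u ! j = (if i = j then u else 0)"
  by (auto simp: unit_vec_def nth_list_update)

lemma char_subgroup_mono_iff: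
  assumes p: "p > 1" and ls: "sorted_wrt (<) ls"
    and a: "a \<in> tuples (set ls)" and b: "b \<in> tuples (set ls)"
  shows "a \<le> b \<longleftrightarrow> char_subgroup p ls a \<subseteq> char_subgroup p ls b"
proof
  assume "a \<le> b"
  then have "p ^ (l - b l) dvd p ^ (l - a l)" for l
    by (intro le_imp_power_dvd diff_le_mono2) (simp add: le_fun_def)
  then show "char_subgroup p ls a \<subseteq> char_subgroup p ls b"
    by (auto simp: char_subgroup_def intro: dvd_trans)
next
  assume sub: "char_subgroup p ls a \<subseteq> char_subgroup p ls b"
  have "a l \<le> b l" if "l \<in> set ls" for l
  proof (cases "a l = 0")
    case False
    obtain i where i: "i < length ls" "l = ls ! i" using \<open>l \<in> set ls\<close> by (metis in_set_conv_nth)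
    have al: "a l \<le> l" using tuplesD(1)[OF a] that .
    \<comment> \<open>A generator of the component tests the inclusion. It is a reduced coordinate
      only because a l is nonzero.\<close>
    let ?e = "unit_vec ls i (p ^ (l - a l))"
    have "?e \<in> carrier (cyc_prod p ls)"
      using p i al False by (intro unit_vec_in) (auto intro: power_strict_increasing)
    then have "?e \<in> char_subgroup p ls a"
      using i by (auto simp: char_subgroup_def unit_vec_nth)
    then have "p ^ (l - b l) dvd ?e ! i" using sub i by (auto simp: char_subgroup_def)
    then have "p ^ (l - b l) dvd p ^ (l - a l)" using i by (simp add: unit_vec_nth)
    then have "l - b l \<le> l - a l" using p by (rule power_dvd_imp_le)
    then show ?thesis using al by linarith
  qed simp
  then show "a \<le> b" using tuples_le_iff[OF a b] by blast
qed

definition transvection :: "nat \<Rightarrow> nat list \<Rightarrow> nat \<Rightarrow> nat \<Rightarrow> nat \<Rightarrow> nat list \<Rightarrow> nat list" where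
  "transvection p ls i j c x = x[j := (x ! j + c * x ! i) mod p ^ (ls ! j)]"

text \<open>Multiplication by \<open>c\<close> is well defined from residues mod \<open>Q\<close> to
  residues mod \<open>P\<close>.\<close>

lemma mult_mod_mod_eq:
  fixes c s P Q :: nat
  assumes "P dvd c * Q"
  shows "c * (s mod Q) mod P = c * s mod P"
proof -
  have "c * s = c * (s mod Q) + c * Q * (s div Q)"
    by (metis add.commute distrib_left mult.assoc mult_div_mod_eq)
  moreover have "P dvd c * Q * (s div Q)" using assms by simp
  ultimately show ?thesis by (metis dvd_imp_mod_0 add.right_neutral mod_add_right_eq)
qed

text \<open>For \<open>i = j\<close> and \<open>c = 1\<close> this is doubling of a coordinate: here \<open>p\<close> odd is needed.\<close>
lemma transvection_iso:
  assumes p: "p > 0" "odd p" and i: "i < length ls" and j: "j < length ls"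
    and c: "p ^ (ls ! j) dvd c * p ^ (ls ! i)" and ij: "i \<noteq> j \<or> c = 1"
  shows "transvection p ls i j c \<in> iso (cyc_prod p ls) (cyc_prod p ls)" (is "?t \<in> iso ?G ?G")
proof -
  interpret G: comm_group ?G using comm_group_cyc_prod p by blast
  have nth: "?t x ! k = (if k = j then (x ! j + c * x ! i) mod p ^ (ls ! j) else x ! k)"
    if "x \<in> carrier ?G" "k < length ls" for x k
    using that by (auto simp: transvection_def mem_cyc_prod nth_list_update)
  have closed: "?t x \<in> carrier ?G" if "x \<in> carrier ?G" for x
    using that p nth[OF that] by (auto simp: mem_cyc_prod transvection_def nth_list_update)
  have "?t (x \<otimes>\<^bsub>?G\<^esub> y) = ?t x \<otimes>\<^bsub>?G\<^esub> ?t y" if xy: "x \<in> carrier ?G" "y \<in> carrier ?G" for x y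
  proof (rule cyc_prod_eqI)
    fix k assume k: "k < length ls"
    let ?P = "p ^ (ls ! j)"
    have "((x ! j + y ! j) mod ?P + c * ((x ! i + y ! i) mod p ^ (ls ! i))) mod ?P
      = (x ! j + y ! j + c * (x ! i + y ! i)) mod ?P"
      by (rule mod_add_cong[OF mod_mod_trivial mult_mod_mod_eq[OF c]])
    also have "\<dots> = ((x ! j + c * x ! i) + (y ! j + c * y ! i)) mod ?P"
      by (simp add: algebra_simps)
    also have "\<dots> = ((x ! j + c * x ! i) mod ?P + (y ! j + c * y ! i) mod ?P) mod ?P"
      by (simp add: mod_add_eq)
    finally show "?t (x \<otimes>\<^bsub>?G\<^esub> y) ! k = (?t x \<otimes>\<^bsub>?G\<^esub> ?t y) ! k"
      using k i j xy by (simp add: nth cyc_prod_mult_nth)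
  qed (use xy closed in auto)
  moreover have inj: "inj_on ?t (carrier ?G)"
  proof (rule inj_onI)
    fix x y assume xy: "x \<in> carrier ?G" "y \<in> carrier ?G" and eq: "?t x = ?t y"
    let ?P = "p ^ (ls ! j)"
    have other: "x ! k = y ! k" if "k < length ls" "k \<noteq> j" for k
      using nth[OF xy(1) that(1)] nth[OF xy(2) that(1)] eq that(2) by simp
    have eqj: "[x ! j + c * x ! i = y ! j + c * y ! i] (mod ?P)"
      using nth[OF xy(1) j] nth[OF xy(2) j] eq by (simp add: cong_def)
    \<comment> \<open>For i = j the coordinate was doubled and 2 is invertible; otherwise coordinate
      i is untouched and its multiple cancels.\<close>
    have "[x ! j = y ! j] (mod ?P)"
    proof (cases "i = j")
      case True
      then have "[2 * x ! j = 2 * y ! j] (mod ?P)" using eqj ij by (simp add: mult_2)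
      moreover have "coprime 2 ?P" using p(2) by simp
      ultimately show ?thesis by (simp add: cong_mult_lcancel_nat)
    next
      case False
      then show ?thesis using eqj other[OF i] by (simp add: cong_add_rcancel_nat)
    qed
    then have "x ! j = y ! j" using xy j by (simp add: cong_def mem_cyc_prod)
    then show "x = y" using other cyc_prod_eqI[OF xy] by metis
  qed
  moreover have "?t ` carrier ?G = carrier ?G"
    using finite_cyc_prod closed inj by (intro endo_inj_surj) auto
  ultimately show ?thesis using closed by (auto simp: iso_def hom_def bij_betw_def)
qed

text \<open>The quotient of the image of \<open>x\<close> under the transvection by \<open>x\<close>
  is supported on coordinate j. For i = j this isolates a coordinate of \<open>x\<close>; for
  distinct i and j it transports one to another factor.\<close>

lemma characteristic_unit_vec:
  assumes p: "p > 0" "odd p" and i: "i < length ls" and j: "j < length ls"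
    and c: "p ^ (ls ! j) dvd c * p ^ (ls ! i)" "i \<noteq> j \<or> c = 1"
    and H: "characteristic H (cyc_prod p ls)" and x: "x \<in> H"
  shows "unit_vec ls j (c * x ! i mod p ^ (ls ! j)) \<in> H"
proof -
  let ?G = "cyc_prod p ls" and ?e = "unit_vec ls j (c * x ! i mod p ^ (ls ! j))"
  let ?t = "transvection p ls i j c x"
  interpret G: comm_group ?G using comm_group_cyc_prod p by blast
  interpret H: subgroup H ?G using H by (simp add: characteristic_def)
  have xc: "x \<in> carrier ?G" using x H.subset by blast
  have t: "?t \<in> H" using H transvection_iso[OF p i j c] x by (auto simp: characteristic_def)
  have e: "?e \<in> carrier ?G" using p j by (intro unit_vec_in) auto
  have "x \<otimes>\<^bsub>?G\<^esub> ?e = ?t"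
  proof (rule cyc_prod_eqI)
    show "?t \<in> carrier ?G" using t H.subset by blast
    show "(x \<otimes>\<^bsub>?G\<^esub> ?e) ! k = ?t ! k" if "k < length ls" for k
      using that xc
      by (auto simp: cyc_prod_mult_nth unit_vec_nth transvection_def mem_cyc_prod nth_list_update
          mod_add_right_eq)
  qed (use xc e in simp)
  then have "?e = inv\<^bsub>?G\<^esub> x \<otimes>\<^bsub>?G\<^esub> ?t" using xc e G.inv_solve_left' by (metis G.m_closed)
  then show ?thesis using t x by simp
qed

lemma unit_vec_scale:
  assumes "p > 0" "i < length ls" "u < p ^ (ls ! i)" "subgroup H (cyc_prod p ls)" "unit_vec ls i u \<in> H"
  shows "unit_vec ls i (k * u mod p ^ (ls ! i)) \<in> H"
proof -
  let ?G = "cyc_prod p ls"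
  interpret G: comm_group ?G using comm_group_cyc_prod assms by blast
  have e: "unit_vec ls i u \<in> carrier ?G" using unit_vec_in assms by blast
  have "unit_vec ls i (k * u mod p ^ (ls ! i)) = unit_vec ls i u [^]\<^bsub>?G\<^esub> k"
    by (rule cyc_prod_eqI[of _ p ls])
      (use assms e in \<open>auto intro!: unit_vec_in simp: cyc_prod_pow_nth unit_vec_nth\<close>)
  moreover have "unit_vec ls i u [^]\<^bsub>?G\<^esub> k \<in> H"
  proof (induction k)
    case 0
    then show ?case using subgroup.one_closed[OF assms(4)] by simp
  next
    case (Suc k)
    then show ?case using subgroup.m_closed[OF assms(4) _ assms(5)] by simp
  qed
  ultimately show ?thesis by simp
qed

lemma mem_if_unit_vecs:
  assumes p: "p > 0" and H: "subgroup H (cyc_prod p ls)" and x: "x \<in> carrier (cyc_prod p ls)"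
    and u: "\<And>i. i < length ls \<Longrightarrow> unit_vec ls i (x ! i) \<in> H"
  shows "x \<in> H"
proof -
  let ?G = "cyc_prod p ls"
  interpret G: comm_group ?G using comm_group_cyc_prod p by blast
  interpret H: subgroup H ?G by (rule H)
  define y where "y k = map (\<lambda>i. if i < k then x ! i else 0) [0..<length ls]" for k
  have yc: "y k \<in> carrier ?G" for k
    using x p by (auto simp: mem_cyc_prod y_def)
  have "k \<le> length ls \<Longrightarrow> y k \<in> H" for k
  proof (induction k)
    case 0
    have "y 0 = \<one>\<^bsub>?G\<^esub>"
      by (rule cyc_prod_eqI[OF yc G.one_closed]) (simp add: y_def cyc_prod_one)
    then show ?case by simp
  next
    case (Suc k)
    have e: "unit_vec ls k (x ! k) \<in> H" using u Suc by simp
    have "y (Suc k) = y k \<otimes>\<^bsub>?G\<^esub> unit_vec ls k (x ! k)"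
    proof (rule cyc_prod_eqI[OF yc])
      show "y k \<otimes>\<^bsub>?G\<^esub> unit_vec ls k (x ! k) \<in> carrier ?G" using yc e by simp
      fix i assume i: "i < length ls"
      consider "i < k" | "i = k" | "i > k" by linarith
      then show "y (Suc k) ! i = (y k \<otimes>\<^bsub>?G\<^esub> unit_vec ls k (x ! k)) ! i"
        using i x by cases (auto simp: cyc_prod_mult_nth unit_vec_nth y_def mem_cyc_prod)
    qed
    then show ?case using Suc e by simp
  qed
  then have "y (length ls) \<in> H" by simp
  moreover have "y (length ls) = x" by (rule cyc_prod_eqI[OF yc x]) (simp add: y_def)
  ultimately show ?thesis by simp
qed

lemma characteristic_eq_char_subgroup:
  assumes p: "Factorial_Ring.prime p" "p \<noteq> 2" and ls: "sorted_wrt (<) ls"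
    and H: "characteristic H (cyc_prod p ls)"
  obtains a where "a \<in> tuples (set ls)" "H = char_subgroup p ls a"
proof -
  let ?G = "cyc_prod p ls"
  have p0: "p > 0" "p > 1" using p(1) prime_gt_0_nat prime_gt_1_nat by auto
  have podd: "odd p" using p prime_odd_nat prime_ge_2_nat by (metis order_le_less)
  interpret G: comm_group ?G using comm_group_cyc_prod p0 by blast
  have sub: "subgroup H ?G" using H by (simp add: characteristic_def)
  interpret H: subgroup H ?G by (rule sub)
  define e where "e i v = unit_vec ls i (p ^ v mod p ^ (ls ! i))" for i v
  \<comment> \<open>The exponent \<open>ls ! i\<close> always qualifies, as it yields the zero
    vector; hence the least one exists and is at most \<open>ls ! i\<close>.\<close>
  define v where "v i = (LEAST v. e i v \<in> H)" for i
  have scale: "unit_vec ls i (k * u mod p ^ (ls ! i)) \<in> H"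
    if "i < length ls" "unit_vec ls i u \<in> H" "u < p ^ (ls ! i)" for i k u
    using unit_vec_scale[OF p0(1) that(1,3) sub that(2)] .
  have move: "unit_vec ls j (c * x ! i mod p ^ (ls ! j)) \<in> H"
    if "i < length ls" "j < length ls" "p ^ (ls ! j) dvd c * p ^ (ls ! i)" "i \<noteq> j \<or> c = 1" "x \<in> H"
    for i j c x
    using characteristic_unit_vec[OF p0(1) podd that(1-4) H that(5)] .
  have full: "e i (ls ! i) \<in> H" if "i < length ls" for i
  proof -
    have "e i (ls ! i) = \<one>\<^bsub>?G\<^esub>" by (simp add: e_def unit_vec_def cyc_prod_one list_update_same_conv that)
    then show ?thesis by simp
  qed
  have v: "e i (v i) \<in> H" "v i \<le> ls ! i" if "i < length ls" for i
    unfolding v_def using full[OF that] by (rule LeastI, rule Least_le)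
  have v_le: "v i \<le> w" if "e i w \<in> H" for i w
    unfolding v_def using that by (rule Least_le)
  have e_nth: "e i w ! i = p ^ w mod p ^ (ls ! i)" if "i < length ls" for i w
    using that by (simp add: e_def unit_vec_nth)
  have coord: "p ^ v i dvd x ! i" if x: "x \<in> H" and i: "i < length ls" for x i
  proof (cases "x ! i = 0")
    case False
    \<comment> \<open>The coordinate is a power of p times a unit. Scaling by an inverse of the unit
      puts \<open>e i m\<close> into \<open>H\<close>, and minimality gives v i \<le> m.\<close>
    define m where "m = multiplicity p (x ! i)"
    obtain u where u: "x ! i = p ^ m * u" "\<not> p dvd u"
      using multiplicity_decompose'[of "x ! i" p] False p(1) not_prime_unit unfolding m_def by metis
    have "coprime u (p ^ (ls ! i))"
      using u(2) p(1) prime_imp_coprime_nat coprime_commute coprime_power_right_iff by metis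
    then obtain u' where u': "[u * u' = 1] (mod p ^ (ls ! i))"
      using cong_solve_coprime_nat by (metis One_nat_def)
    have xi: "x ! i < p ^ (ls ! i)" using x H.subset i by (auto simp: mem_cyc_prod)
    have "unit_vec ls i (x ! i) \<in> H" using move[OF i i _ _ x, of 1] xi by simp
    then have "unit_vec ls i (u' * x ! i mod p ^ (ls ! i)) \<in> H" using scale i xi by blast
    moreover have "[u' * x ! i = p ^ m] (mod p ^ (ls ! i))"
      using cong_scalar_left[OF u', of "p ^ m"] u(1) by (simp add: ac_simps)
    ultimately have "e i m \<in> H" by (simp add: e_def cong_def)
    then have "p ^ v i dvd p ^ m" by (intro le_imp_power_dvd v_le)
    then show ?thesis using u(1) by simp
  qed simp
  have conv: "x \<in> H" if x: "x \<in> carrier ?G" and d: "\<And>i. i < length ls \<Longrightarrow> p ^ v i dvd x ! i" for x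
  proof (rule mem_if_unit_vecs[OF p0(1) sub x])
    fix i assume i: "i < length ls"
    obtain k where k: "x ! i = p ^ v i * k" using d[OF i] by blast
    have "unit_vec ls i (k * (p ^ v i mod p ^ (ls ! i)) mod p ^ (ls ! i)) \<in> H"
      using scale[OF i] v(1)[OF i] p0 unfolding e_def by simp
    moreover have "k * (p ^ v i mod p ^ (ls ! i)) mod p ^ (ls ! i) = x ! i mod p ^ (ls ! i)"
      by (simp add: k mod_mult_right_eq mult.commute)
    moreover have "x ! i < p ^ (ls ! i)" using x i by (simp add: mem_cyc_prod)
    ultimately show "unit_vec ls i (x ! i) \<in> H" by simp
  qed
  \<comment> \<open>Reduction from the larger factor to the smaller (c = 1) gives \<open>up\<close>;
    the embedding of the smaller into the larger gives \<open>down\<close>. In terms of orders,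
    \<open>up\<close> bounds the increments and \<open>down\<close> is monotonicity.\<close>
  have up: "v i \<le> v j" and down: "v j \<le> v i + (ls ! j - ls ! i)" if ij: "i < j" "j < length ls" for i j
  proof -
    have l: "ls ! i < ls ! j" using sorted_wrt_nth_less[OF ls ij] .
    have i: "i < length ls" using ij by simp
    have "p ^ (ls ! i) dvd 1 * p ^ (ls ! j)" using l by (simp add: le_imp_power_dvd)
    then have "unit_vec ls i (1 * e j (v j) ! j mod p ^ (ls ! i)) \<in> H"
      using move[OF ij(2) i _ _ v(1)[OF ij(2)]] ij(1) by blast
    moreover have "1 * e j (v j) ! j mod p ^ (ls ! i) = p ^ v j mod p ^ (ls ! i)"
      using l by (simp add: e_nth[OF ij(2)] mod_mod_cancel le_imp_power_dvd)
    ultimately show "v i \<le> v j" by (intro v_le) (simp add: e_def)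
    let ?c = "p ^ (ls ! j - ls ! i)"
    have c: "p ^ (ls ! j) dvd ?c * p ^ (ls ! i)" using l by (simp flip: power_add)
    then have "unit_vec ls j (?c * e i (v i) ! i mod p ^ (ls ! j)) \<in> H"
      using move[OF i ij(2) c _ v(1)[OF i]] ij(1) by blast
    moreover have "?c * e i (v i) ! i mod p ^ (ls ! j) = p ^ (v i + (ls ! j - ls ! i)) mod p ^ (ls ! j)"
      using mult_mod_mod_eq[OF c, of "p ^ v i"] by (simp add: e_nth[OF i] power_add mult.commute)
    ultimately show "v j \<le> v i + (ls ! j - ls ! i)" by (intro v_le) (simp add: e_def)
  qed
  have inj: "inj_on ((!) ls) {..<length ls}"
    using sorted_wrt_nth_less[OF ls] by (intro inj_onI) (metis lessThan_iff less_irrefl linorder_neqE_nat)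
  \<comment> \<open>Passage from minimal valuations to orders; the index is recovered from the
    exponent because the exponents are distinct.\<close>
  define a where "a l = (if l \<in> set ls then l - v (inv_into {..<length ls} ((!) ls) l) else 0)" for l
  have a: "a (ls ! i) = ls ! i - v i" if "i < length ls" for i
    using that inv_into_f_f[OF inj, of i] by (simp add: a_def)
  have "a \<in> tuples (set ls)"
  proof -
    have "a (ls ! i) \<le> a (ls ! j) \<and> a (ls ! j) + ls ! i \<le> a (ls ! i) + ls ! j"
      if "i < length ls" "j < length ls" "ls ! i \<le> ls ! j" for i j
    proof -
      have "i \<le> j" using sorted_wrt_nth_less[OF ls, of j i] that by (meson leD leI)
      then show ?thesis
        using up[of i j] down[of i j] v(2)[of i] v(2)[of j] that
        by (cases "i = j") (auto simp: a)
    qed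
    then have "a l \<le> a k \<and> a k + l \<le> a l + k" if "l \<in> set ls" "k \<in> set ls" "l \<le> k" for l k
      using that by (metis in_set_conv_nth)
    moreover have "a l \<le> l" "l \<notin> set ls \<Longrightarrow> a l = 0" for l by (simp_all add: a_def)
    ultimately show ?thesis unfolding tuples_def by blast
  qed
  moreover have "H = char_subgroup p ls a"
  proof (intro Set.set_eqI)
    fix x
    show "x \<in> H \<longleftrightarrow> x \<in> char_subgroup p ls a"
      using coord[of x] conv[of x] H.subset v(2) by (auto simp: char_subgroup_def a)
  qed
  ultimately show ?thesis using that by blast
qed

section \<open>From groups to tuples, and the classification for lists\<close>

lemma order_iso_char_subgroup:
  assumes p: "Factorial_Ring.prime p" "p \<noteq> 2" and ls: "sorted_wrt (<) ls"
  shows "order_iso (\<le>) (\<subseteq>) (char_subgroup p ls) (tuples (set ls)) (Char (cyc_prod p ls))"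
proof -
  have p0: "p > 0" "p > 1" using p(1) prime_gt_0_nat prime_gt_1_nat by auto
  have "inj_on (char_subgroup p ls) (tuples (set ls))"
    by (rule inj_onI) (metis char_subgroup_mono_iff[OF p0(2) ls] antisym order_refl)
  moreover have "char_subgroup p ls ` tuples (set ls) = Char (cyc_prod p ls)"
  proof
    show "char_subgroup p ls ` tuples (set ls) \<subseteq> Char (cyc_prod p ls)"
      using characteristic_char_subgroup[OF p0(1) ls] by (auto simp: Char_def)
    show "Char (cyc_prod p ls) \<subseteq> char_subgroup p ls ` tuples (set ls)"
    proof
      fix H assume "H \<in> Char (cyc_prod p ls)"
      then have "characteristic H (cyc_prod p ls)" by (simp add: Char_def)
      then show "H \<in> char_subgroup p ls ` tuples (set ls)"
        by (rule characteristic_eq_char_subgroup[OF p ls]) blast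
    qed
  qed
  ultimately show ?thesis
    unfolding order_iso_def bij_betw_def using char_subgroup_mono_iff[OF p0(2) ls] by blast
qed

lemma char_lattice_iso_iff:
  assumes p: "Factorial_Ring.prime p" "p \<noteq> 2" and ls: "sorted_wrt (<) ls" and ms: "sorted_wrt (<) ms"
  shows "char_lattice_iso (cyc_prod p ls) (cyc_prod p ms) \<longleftrightarrow>
    (\<exists>f. order_iso (\<le>) (\<le>) f (tuples (set ls)) (tuples (set ms)))"
proof -
  have "char_lattice_iso (cyc_prod p ls) (cyc_prod p ms) \<longleftrightarrow>
      (\<exists>f. order_iso (\<subseteq>) (\<subseteq>) f (Char (cyc_prod p ls)) (Char (cyc_prod p ms)))"
    by (simp add: char_lattice_iso_def order_iso_def)
  then show ?thesis
    using order_iso_char_subgroup[OF p ls] order_iso_char_subgroup[OF p ms]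
      order_iso_comp order_iso_inv by meson
qed

lemma exceptional_lists:
  fixes ls ms :: "nat list"
  assumes "sorted_wrt (<) ls" "sorted_wrt (<) ms" "exceptional (set ls) (set ms)"
  shows "(\<exists>k\<ge>1. ls = [k, k + 1] \<and> ms = [2 * k + 1]) \<or> (ls = [1, 2, 4] \<and> ms = [2, 5])"
proof -
  have eq: "xs = ys" if "sorted_wrt (<) xs" "sorted_wrt (<) ys" "set xs = set ys" for xs ys :: "nat list"
    using strict_sorted_equal that by blast
  from assms(3) show ?thesis unfolding exceptional_def
  proof (elim disjE exE conjE)
    fix k :: nat assume k: "1 \<le> k" "set ls = {k, Suc k}" "set ms = {2 * k + 1}"
    then have "ls = [k, k + 1]" "ms = [2 * k + 1]"
      using eq[OF assms(1), of "[k, k + 1]"] eq[OF assms(2), of "[2 * k + 1]"] by auto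
    then show ?thesis using k(1) by blast
  next
    assume "set ls = {1, 2, 4}" "set ms = {2, 5}"
    then have "ls = [1, 2, 4]" "ms = [2, 5]"
      using eq[OF assms(1), of "[1, 2, 4]"] eq[OF assms(2), of "[2, 5]"] by auto
    then show ?thesis by blast
  qed
qed

theorem mainTheorem1:
  fixes p :: nat and ls ms :: "nat list"
  assumes "Factorial_Ring.prime p" and "p \<noteq> 2"
    and "ls \<noteq> []" and "sorted_wrt (<) ls" and "\<forall>x\<in>set ls. 0 < x"
    and "ms \<noteq> []" and "sorted_wrt (<) ms" and "\<forall>x\<in>set ms. 0 < x"
    and "length ms \<le> length ls"
  shows "char_lattice_iso (cyc_prod p ls) (cyc_prod p ms) \<longleftrightarrow>
           ls = ms
         \<or> (\<exists>k::nat. k \<ge> 1 \<and> ls = [k, k + 1] \<and> ms = [2 * k + 1])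
         \<or> (ls = [1, 2, 4] \<and> ms = [2, 5])"
proof -
  have iso: "char_lattice_iso (cyc_prod p ls) (cyc_prod p ms) \<longleftrightarrow>
      (\<exists>f. order_iso (\<le>) (\<le>) f (tuples (set ls)) (tuples (set ms)))"
    using char_lattice_iso_iff assms by blast
  show ?thesis
  proof
    assume "char_lattice_iso (cyc_prod p ls) (cyc_prod p ms)"
    then obtain f where "order_iso (\<le>) (\<le>) f (tuples (set ls)) (tuples (set ms))"
      using iso by blast
    then obtain g where "point_iso g (points (set ls)) (points (set ms))"
      by (rule tuples_iso_imp_point_iso)
    then have "set ls = set ms \<or> exceptional (set ls) (set ms) \<or> exceptional (set ms) (set ls)"
      using assms by (intro point_iso_classification) auto
    \<comment> \<open>An exceptional pair has its longer list first, so the reversed orientation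
      contradicts the assumption on lengths.\<close>
    moreover have "\<not> exceptional (set ms) (set ls)"
      using exceptional_lists[OF assms(7,4)] assms(9) by auto
    ultimately show "ls = ms \<or> (\<exists>k\<ge>1. ls = [k, k + 1] \<and> ms = [2 * k + 1]) \<or>
        (ls = [1, 2, 4] \<and> ms = [2, 5])"
      using strict_sorted_equal[OF assms(4,7)] exceptional_lists[OF assms(4,7)] by blast
  next
    assume "ls = ms \<or> (\<exists>k\<ge>1. ls = [k, k + 1] \<and> ms = [2 * k + 1]) \<or>
        (ls = [1, 2, 4] \<and> ms = [2, 5])"
    then show "char_lattice_iso (cyc_prod p ls) (cyc_prod p ms)"
    proof (elim disjE exE conjE)
      assume "ls = ms"
      then have "order_iso (\<le>) (\<le>) (\<lambda>a. a) (tuples (set ls)) (tuples (set ms))"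
        by (simp add: order_iso_def bij_betw_def inj_on_def)
      then show ?thesis using iso by blast
    next
      fix k :: nat assume k: "1 \<le> k" "ls = [k, k + 1]" "ms = [2 * k + 1]"
      then show ?thesis using tuples_chain_iso[OF k(1)] iso by auto
    next
      assume "ls = [1, 2, 4]" "ms = [2, 5]"
      then show ?thesis using tuples_124_iso iso by auto
    qed
  qed
qed

end
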